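(* Let $M$ be a Buffon set of $m$ segments of length $\ell$. The expected complexity of $M$ is $\Theta(m^2 \ell^2+m)$.
   Context: A Buffon set $M=M(m,\ell)$ is a random set of $m$ line segments, each of length $\ell$, placed independently in the unit square, with centers uniform in the unit square and angles uniform. $P(M)$ is the set of points lying on at least two segments, $J(M)$ the set of segment endpoints. $G_M$ is the plane graph with vertex set $P(M)\cup J(M)$ in which $u,v$ are adjacent iff some segment $s\in M$ contains both and no point of $P(M)\cup J(M)$ lies on $s$ strictly between them, embedded as drawn by $M$. The complexity of $M$ is the number of vertices plus the number of edges plus the number of bounded faces of $G_M$.
   Formalization: The Θ bound is proved uniformly over all m and all 0 < ℓ ≤ L, for any fixed bound L, with constants depending on L; for unbounded ℓ the claim fails (for m = 1 the complexity is always 3, while m²ℓ²+m = ℓ²+1). *)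

theory Defs
  imports "HOL-Probability.Probability" "HOL-Library.Landau_Symbols"
begin

type_synonym point = "real \<times> real"

text \<open>A segment is its point set; since \<open>closed_segment a b\<close> determines \<open>{a, b}\<close>,
  its endpoints can be recovered from it.\<close>

definition crossing_points :: "point set set \<Rightarrow> point set" where
  "crossing_points M = {x. \<exists>s\<in>M. \<exists>t\<in>M. s \<noteq> t \<and> x \<in> s \<and> x \<in> t}"

definition end_points :: "point set set \<Rightarrow> point set" where
  "end_points M = {a. \<exists>b. closed_segment a b \<in> M}"

definition graph_verts :: "point set set \<Rightarrow> point set" where
  "graph_verts M = crossing_points M \<union> end_points M"

definition graph_edges :: "point set set \<Rightarrow> point set set" where
  "graph_edges M = {{u, v} | u v. u \<in> graph_verts M \<and> v \<in> graph_verts M \<and> u \<noteq> v \<and>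
     (\<exists>s\<in>M. u \<in> s \<and> v \<in> s \<and> graph_verts M \<inter> s \<inter> open_segment u v = {})}"

text \<open>The graph is embedded as drawn by \<open>M\<close>, so its faces are the connected components of the
  complement of the union of the segments.\<close>

definition bounded_faces :: "point set set \<Rightarrow> point set set" where
  "bounded_faces M = {F \<in> components (- \<Union>M). bounded F}"

text \<open>If two distinct segments overlap in more than one point, then there are infinitely many
  crossing points and \<^const>\<open>card\<close> returns 0 for the vertex set. For a Buffon set this is
  an event of probability 0.\<close>

definition complexity :: "point set set \<Rightarrow> nat" where
  "complexity M = card (graph_verts M) + card (graph_edges M) + card (bounded_faces M)"

definition placed_segment :: "real \<Rightarrow> point \<times> real \<Rightarrow> point set" where
  "placed_segment l = (\<lambda>(c, \<theta>).
     closed_segment (c - (l / 2) *\<^sub>R (cos \<theta>, sin \<theta>)) (c + (l / 2) *\<^sub>R (cos \<theta>, sin \<theta>)))"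

definition placement_measure :: "(point \<times> real) measure" where
  "placement_measure =
     uniform_measure lborel ({0..1} \<times> {0..1}) \<Otimes>\<^sub>M uniform_measure lborel {0..<pi}"

definition buffon_space :: "nat \<Rightarrow> (nat \<Rightarrow> point \<times> real) measure" where
  "buffon_space m = Pi\<^sub>M {..<m} (\<lambda>_. placement_measure)"

definition buffon_set :: "nat \<Rightarrow> real \<Rightarrow> (nat \<Rightarrow> point \<times> real) \<Rightarrow> point set set" where
  "buffon_set m l \<omega> = (\<lambda>i. placed_segment l (\<omega> i)) ` {..<m}"

definition expected_complexity :: "nat \<Rightarrow> real \<Rightarrow> real" where
  "expected_complexity m l =
     enn2real (\<integral>\<^sup>+ \<omega>. of_nat (complexity (buffon_set m l \<omega>)) \<partial>buffon_space m)"

end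

theory Submission
  imports Defs
begin

text \<open>Almost surely no two segments are parallel and no three are concurrent. Up to constants, the
  complexity is then the number of intersecting pairs plus \<open>m\<close>. For the upper bound, count the pairs
  of a segment and a vertex on it: each such pair accounts for the edge that follows the vertex along
  the segment and for the two faces on either side of that edge, and every bounded face arises in this
  way because its frontier is infinite and so contains a point that is not a vertex. For the lower
  bound, distinct intersecting pairs give distinct crossing points, and at most two segments share
  an endpoint. Finally, two segments meet with probability of order \<open>l\<^sup>2\<close>: meeting
  forces the centers to be within \<open>l\<close> of each other, and conversely two segments meet if their centers
  differ by at most \<open>l/8\<close> in each coordinate and the sine of their angle is at least \<open>1/2\<close>.\<close>

section \<open>Geometry of placed segments\<close>

definition cross :: "point \<Rightarrow> point \<Rightarrow> real" where
  "cross v w = fst v * snd w - snd v * fst w"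

definition direction :: "point \<times> real \<Rightarrow> point" where
  "direction p = (cos (snd p), sin (snd p))"

definition normal :: "point \<times> real \<Rightarrow> point" where
  "normal p = (- sin (snd p), cos (snd p))"

text \<open>This parametrizes the whole supporting line by signed distance from the center. Points
  of a segment become real numbers, whose order describes consecutive vertices.\<close>

definition axis_point :: "point \<times> real \<Rightarrow> real \<Rightarrow> point" where
  "axis_point p t = fst p + t *\<^sub>R direction p"

lemma cross_direction: "cross (direction p) (direction q) = sin (snd q - snd p)"
  by (simp add: cross_def direction_def sin_diff algebra_simps)

lemma norm_direction: "norm (direction p) = 1"
  by (simp add: direction_def norm_prod_def)

lemma norm_normal: "norm (normal p) = 1"
  by (simp add: normal_def norm_prod_def)

lemma axis_point_image_closed_segment:
  "axis_point p ` closed_segment s t = closed_segment (axis_point p s) (axis_point p t)"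
proof -
  have "linear (\<lambda>r. r *\<^sub>R direction p)"
    by (rule bounded_linear.linear, rule bounded_linear_scaleR_left)
  from closed_segment_linear_image[OF this, of s t] show ?thesis
    unfolding axis_point_def closed_segment_translation by (simp add: image_image)
qed

lemma placed_segment_eq_closed_segment:
  "placed_segment l p = closed_segment (axis_point p (-l/2)) (axis_point p (l/2))"
  by (cases p) (simp add: placed_segment_def axis_point_def direction_def minus_prod_def plus_prod_def del: closed_segment_eq)

lemma placed_segment_eq_image:
  assumes "l > 0"
  shows "placed_segment l p = axis_point p ` {-l/2..l/2}"
  using assms unfolding placed_segment_eq_closed_segment axis_point_image_closed_segment[symmetric]
  by (simp add: closed_segment_eq_real_ivl)

lemma axis_point_eq_iff [simp]: "axis_point p s = axis_point p t \<longleftrightarrow> s = t"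
proof -
  have "direction p \<noteq> 0" using norm_direction[of p] by force
  then show ?thesis by (auto simp: axis_point_def)
qed

text \<open>\<open>direction p\<close> and \<open>normal p\<close> form an orthonormal basis, so the
  coordinates are inner products and Cauchy-Schwarz bounds them. This puts a point close to a
  segment into a strip alongside it.\<close>

lemma axis_coordinates:
  obtains s h where "y = axis_point p t + s *\<^sub>R direction p + h *\<^sub>R normal p"
    "\<bar>s\<bar> \<le> dist y (axis_point p t)" "\<bar>h\<bar> \<le> dist y (axis_point p t)"
proof -
  define d where "d = y - axis_point p t"
  define s h where "s = d \<bullet> direction p" and "h = d \<bullet> normal p"
  have sc: "cos (snd p) * cos (snd p) = 1 - sin (snd p) * sin (snd p)"
    using sin_cos_squared_add3[of "snd p"] by linarith
  have "d = s *\<^sub>R direction p + h *\<^sub>R normal p"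
    by (rule prod_eqI) (auto simp: s_def h_def direction_def normal_def inner_prod_def algebra_simps sc)
  moreover have "\<bar>s\<bar> \<le> norm d" "\<bar>h\<bar> \<le> norm d"
    using Cauchy_Schwarz_ineq2[of d "direction p"] Cauchy_Schwarz_ineq2[of d "normal p"]
    by (simp_all add: s_def h_def norm_direction norm_normal)
  ultimately show thesis
    by (intro that[of s h]) (auto simp: d_def dist_norm algebra_simps)
qed

text \<open>The inner product with \<open>normal p\<close> is constant along the axis and detects
  the offset \<open>h\<close>.\<close>

lemma off_axis:
  assumes "axis_point p t + h *\<^sub>R normal p = axis_point p t'"
  shows "h = 0"
proof -
  have "normal p \<bullet> (axis_point p t + h *\<^sub>R normal p) = normal p \<bullet> axis_point p t'"
    using assms by simp
  then have "h * (normal p \<bullet> normal p) + t * (normal p \<bullet> direction p) = t' * (normal p \<bullet> direction p)"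
    by (simp add: axis_point_def inner_add_right)
  moreover have "normal p \<bullet> direction p = 0" by (simp add: normal_def direction_def inner_prod_def)
  moreover have "normal p \<bullet> normal p = 1" using norm_normal[of p] by (simp add: norm_eq_1)
  ultimately show "h = 0" by simp
qed

text \<open>Subtracting the two equations makes a multiple of \<open>direction p\<close> equal to a
  multiple of \<open>direction q\<close>. Taking \<open>cross\<close> with
  \<open>direction q\<close> kills the latter and leaves \<open>s - t\<close> times a nonzero
  sine.\<close>

lemma axes_meet_once:
  assumes "sin (snd p - snd q) \<noteq> 0"
    and "axis_point p s = axis_point q s'" "axis_point p t = axis_point q t'"
  shows "s = t"
proof -
  have "(s - t) *\<^sub>R direction p = (s' - t') *\<^sub>R direction q"
    using assms(2,3) by (simp add: axis_point_def scaleR_left_diff_distrib)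
      (metis (no_types, opaque_lifting) add_diff_cancel_left)
  then have "cross ((s - t) *\<^sub>R direction p) (direction q) = cross ((s' - t') *\<^sub>R direction q) (direction q)"
    by simp
  then have "(s - t) * cross (direction p) (direction q) = (s' - t') * cross (direction q) (direction q)"
    by (simp add: cross_def algebra_simps)
  moreover have "sin (snd q - snd p) \<noteq> 0"
    using assms(1) by (metis minus_diff_eq neg_equal_0_iff_equal sin_minus)
  ultimately show ?thesis by (simp add: cross_direction)
qed

text \<open>Removing a finite set from a space of dimension at least 2 leaves it connected. A
  connected set that meets both \<open>F\<close> and its complement must meet the frontier of
  \<open>F\<close>, so a finite frontier is impossible.\<close>

lemma infinite_frontier_of_bounded:
  fixes F :: "'a::euclidean_space set"
  assumes "bounded F" "open F" "F \<noteq> {}" "2 \<le> DIM('a)"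
  shows "infinite (frontier F)"
proof
  assume fin: "finite (frontier F)"
  have conn: "connected (UNIV - frontier F)"
    by (rule connected_open_delete_finite[OF open_UNIV connected_UNIV assms(4) fin])
  have "F \<inter> frontier F = {}" using assms(2) by (simp add: frontier_def interior_open)
  then have "(UNIV - frontier F) \<inter> F \<noteq> {}" using assms(3) by blast
  \<comment> \<open>Otherwise the whole space would be the union of the bounded set \<open>F\<close>
    and a finite set.\<close>
  moreover have "(UNIV - frontier F) - F \<noteq> {}"
  proof
    assume "(UNIV - frontier F) - F = {}"
    then have "bounded (UNIV :: 'a set)"
      by (metis Diff_eq_empty_iff Diff_subset_conv assms(1) bounded_Un bounded_subset fin finite_imp_bounded)
    then show False by simp
  qed
  ultimately show False
    using connected_Int_frontier[OF conn, of F] by blast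
qed


lemma open_segment_axis_point:
  assumes "s < r" "r < t"
  shows "axis_point p r \<in> open_segment (axis_point p s) (axis_point p t)"
proof -
  have "axis_point p r \<in> axis_point p ` closed_segment s t"
    using assms by (auto simp: closed_segment_eq_real_ivl)
  then show ?thesis
    using assms by (auto simp: axis_point_image_closed_segment open_segment_def)
qed

section \<open>Arrangements of pairwise transversal segments\<close>

text \<open>A nonzero sine of the angle difference says that the supporting lines are not parallel.
  Concurrency of three segments is excluded only in \<open>complexity_lower\<close>, where a pair
  has to be recovered from its crossing point.\<close>

locale segment_arrangement =
  fixes m :: nat and l :: real and \<omega> :: "nat \<Rightarrow> point \<times> real"
  assumes length_pos: "l > 0"
    and transversal: "\<And>i j. i < m \<Longrightarrow> j < m \<Longrightarrow> i \<noteq> j \<Longrightarrow> sin (snd (\<omega> i) - snd (\<omega> j)) \<noteq> 0"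
begin

abbreviation seg :: "nat \<Rightarrow> point set" where
  "seg i \<equiv> placed_segment l (\<omega> i)"

abbreviation M :: "point set set" where
  "M \<equiv> buffon_set m l \<omega>"

definition neighbours :: "nat \<Rightarrow> nat set" where
  "neighbours i = {j. j < m \<and> j \<noteq> i \<and> seg i \<inter> seg j \<noteq> {}}"

definition vertex_params :: "nat \<Rightarrow> real set" where
  "vertex_params i = {t \<in> {-l/2..l/2}. axis_point (\<omega> i) t \<in> graph_verts M}"

text \<open>A vertex yields one flag for each segment through it. Vertices, edges and bounded faces
  are all counted against this one finite set.\<close>

definition flags :: "(nat \<times> real) set" where
  "flags = (SIGMA i:{..<m}. vertex_params i)"

lemma seg_image: "seg i = axis_point (\<omega> i) ` {-l/2..l/2}"
  by (rule placed_segment_eq_image[OF length_pos])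

lemma ends_in_seg: "axis_point (\<omega> i) (-l/2) \<in> seg i" "axis_point (\<omega> i) (l/2) \<in> seg i"
  using length_pos by (auto simp: seg_image)

lemma meet_once:
  assumes "i < m" "j < m" "i \<noteq> j" "x \<in> seg i" "x \<in> seg j" "y \<in> seg i" "y \<in> seg j"
  shows "x = y"
  using assms axes_meet_once[OF transversal[OF assms(1-3)]] unfolding seg_image by blast

text \<open>Equal segments share both of their distinct ends, against \<open>meet_once\<close>.
  Hence \<open>buffon_set\<close>, a set of point sets, loses no segment by coincidence, and
  distinct segments can be read as distinct indices.\<close>

lemma seg_inj:
  assumes "i < m" "j < m" "seg i = seg j"
  shows "i = j"
proof (rule ccontr)
  assume "i \<noteq> j"
  note ends_in_seg[of i]
  with meet_once[OF assms(1,2) \<open>i \<noteq> j\<close>] assms(3) have "axis_point (\<omega> i) (-l/2) = axis_point (\<omega> i) (l/2)"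
    by blast
  then show False using length_pos by simp
qed

section \<open>Vertices lying on a given segment\<close>

lemma crossing_points_eq: "crossing_points M = (\<Union>i<m. \<Union>j\<in>{..<m} - {i}. seg i \<inter> seg j)"
proof (intro equalityI subsetI)
  fix x assume "x \<in> crossing_points M"
  then obtain i j where "i < m" "j < m" "seg i \<noteq> seg j" "x \<in> seg i" "x \<in> seg j"
    unfolding crossing_points_def buffon_set_def by blast
  then show "x \<in> (\<Union>i<m. \<Union>j\<in>{..<m} - {i}. seg i \<inter> seg j)" by blast
next
  fix x assume "x \<in> (\<Union>i<m. \<Union>j\<in>{..<m} - {i}. seg i \<inter> seg j)"
  then obtain i j where "i < m" "j < m" "i \<noteq> j" "x \<in> seg i" "x \<in> seg j" by blast
  moreover from this have "seg i \<noteq> seg j" using seg_inj by blast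
  ultimately show "x \<in> crossing_points M"
    unfolding crossing_points_def buffon_set_def by blast
qed

lemma end_points_eq: "end_points M = (\<Union>i<m. {axis_point (\<omega> i) (-l/2), axis_point (\<omega> i) (l/2)})"
proof (intro equalityI subsetI)
  fix x assume "x \<in> end_points M"
  then obtain b i where "i < m" "closed_segment x b = seg i"
    unfolding end_points_def buffon_set_def by blast
  then show "x \<in> (\<Union>i<m. {axis_point (\<omega> i) (-l/2), axis_point (\<omega> i) (l/2)})"
    unfolding placed_segment_eq_closed_segment closed_segment_eq by blast
next
  fix x assume "x \<in> (\<Union>i<m. {axis_point (\<omega> i) (-l/2), axis_point (\<omega> i) (l/2)})"
  then obtain i where "i < m" "x = axis_point (\<omega> i) (-l/2) \<or> x = axis_point (\<omega> i) (l/2)" by blast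
  then have "\<exists>b. closed_segment x b = seg i"
    unfolding placed_segment_eq_closed_segment by (metis closed_segment_commute)
  then show "x \<in> end_points M"
    using \<open>i < m\<close> unfolding end_points_def buffon_set_def by force
qed

text \<open>An end of another segment that lies on segment \<open>i\<close> is already a common
  point of two segments, so it falls under the third case.\<close>

lemma vertex_in_seg_cases:
  assumes "i < m" "x \<in> graph_verts M" "x \<in> seg i"
  obtains "x = axis_point (\<omega> i) (-l/2)" | "x = axis_point (\<omega> i) (l/2)"
  | j where "j < m" "j \<noteq> i" "x \<in> seg j"
proof -
  consider j k where "j < m" "k < m" "j \<noteq> k" "x \<in> seg j" "x \<in> seg k"
    | j where "j < m" "x = axis_point (\<omega> j) (-l/2) \<or> x = axis_point (\<omega> j) (l/2)"
    using assms(2) unfolding graph_verts_def crossing_points_eq end_points_eq by blast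
  then show thesis
  proof cases
    case (1 j k)
    then show thesis using that(3) by (cases "j = i") auto
  next
    case (2 j)
    then have "x \<in> seg j" using ends_in_seg by blast
    then show thesis using 2 that by (cases "j = i") auto
  qed
qed

text \<open>Besides its two ends, a segment carries at most one vertex for each neighbour, since two
  segments share at most one point.\<close>

lemma finite_vertex_params: "i < m \<Longrightarrow> finite (vertex_params i)"
  and card_vertex_params: "i < m \<Longrightarrow> card (vertex_params i) \<le> 2 + card (neighbours i)"
proof -
  assume i: "i < m"
  \<comment> \<open>The parameter of the common point with segment \<open>j\<close>; by
    \<open>meet_once\<close> the description is unique whenever such a point exists.\<close>
  define f where "f j = (THE t. axis_point (\<omega> i) t \<in> seg i \<inter> seg j)" for j
  have fin: "finite (neighbours i)" unfolding neighbours_def by auto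
  have sub: "vertex_params i \<subseteq> {-l/2, l/2} \<union> f ` neighbours i"
  proof
    fix t assume t: "t \<in> vertex_params i"
    then have ti: "axis_point (\<omega> i) t \<in> seg i" and tv: "axis_point (\<omega> i) t \<in> graph_verts M"
      by (auto simp: vertex_params_def seg_image)
    from vertex_in_seg_cases[OF i tv ti] show "t \<in> {-l/2, l/2} \<union> f ` neighbours i"
    proof cases
      case (3 j)
      have "f j = t"
        unfolding f_def
      proof (rule the_equality)
        fix s assume "axis_point (\<omega> i) s \<in> seg i \<inter> seg j"
        then have "axis_point (\<omega> i) s = axis_point (\<omega> i) t"
          using meet_once[OF i 3(1) 3(2)[symmetric]] ti 3(3) by blast
        then show "s = t" by simp
      qed (use ti 3 in blast)
      moreover have "j \<in> neighbours i" using 3 ti by (auto simp: neighbours_def)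
      ultimately show ?thesis by blast
    qed auto
  qed
  show "finite (vertex_params i)" by (rule finite_subset[OF sub]) (use fin in auto)
  have "card (vertex_params i) \<le> card ({-l/2, l/2} \<union> f ` neighbours i)"
    by (rule card_mono[OF _ sub]) (use fin in auto)
  also have "\<dots> \<le> card {-l/2, l/2} + card (f ` neighbours i)" by (rule card_Un_le)
  also have "\<dots> \<le> 2 + card (neighbours i)"
    by (intro add_mono card_image_le fin) (auto simp: card_insert_if)
  finally show "card (vertex_params i) \<le> 2 + card (neighbours i)" .
qed

lemma finite_flags: "finite flags"
  unfolding flags_def using finite_vertex_params by auto

lemma card_flags: "card flags \<le> (\<Sum>i<m. 2 + card (neighbours i))"
  unfolding flags_def using finite_vertex_params card_vertex_params
  by (subst card_SigmaI) (auto intro!: sum_mono)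

section \<open>Counting vertices and edges by flags\<close>

lemma graph_verts_subset: "graph_verts M \<subseteq> (\<lambda>(i, t). axis_point (\<omega> i) t) ` flags"
proof
  fix x assume x: "x \<in> graph_verts M"
  then obtain i where i: "i < m" "x \<in> seg i"
    unfolding graph_verts_def crossing_points_eq end_points_eq using ends_in_seg by auto
  then obtain t where t: "t \<in> {-l/2..l/2}" "x = axis_point (\<omega> i) t" by (auto simp: seg_image)
  have "(i, t) \<in> flags" using i t x by (auto simp: flags_def vertex_params_def)
  then show "x \<in> (\<lambda>(i, t). axis_point (\<omega> i) t) ` flags" using t by force
qed

lemma finite_graph_verts: "finite (graph_verts M)"
  using finite_subset[OF graph_verts_subset] finite_flags by blast

lemma card_graph_verts_le: "card (graph_verts M) \<le> card flags"
  by (meson graph_verts_subset finite_flags surj_card_le)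

text \<open>An edge is charged to its end with the smaller parameter: the other end is the next
  vertex along the segment. At the last vertex \<open>Min\<close> is applied to the empty set, which
  is harmless because only an inclusion is claimed.\<close>

lemma graph_edges_subset:
  "graph_edges M \<subseteq> (\<lambda>(i, a). {axis_point (\<omega> i) a, axis_point (\<omega> i) (Min {b \<in> vertex_params i. a < b})}) ` flags"
    (is "_ \<subseteq> ?e ` _")
proof -
  have *: "{axis_point (\<omega> i) a, axis_point (\<omega> i) b} \<in> ?e ` flags"
    if i: "i < m" and ab: "a < b" "a \<in> vertex_params i" "b \<in> vertex_params i"
      and emp: "graph_verts M \<inter> seg i \<inter> open_segment (axis_point (\<omega> i) a) (axis_point (\<omega> i) b) = {}"
    for i a b
  proof -
    \<comment> \<open>A vertex parameter strictly between \<open>a\<close> and \<open>b\<close>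
      would give a vertex inside the open segment, which the definition of an edge forbids.\<close>
    have "Min {b \<in> vertex_params i. a < b} = b"
    proof (rule Min_eqI)
      fix r assume r: "r \<in> {b \<in> vertex_params i. a < b}"
      show "b \<le> r"
      proof (rule ccontr)
        assume "\<not> b \<le> r"
        then have "axis_point (\<omega> i) r \<in> open_segment (axis_point (\<omega> i) a) (axis_point (\<omega> i) b)"
          using r by (intro open_segment_axis_point) auto
        moreover have "axis_point (\<omega> i) r \<in> graph_verts M \<inter> seg i"
          using r by (auto simp: vertex_params_def seg_image)
        ultimately show False using emp by blast
      qed
    qed (use finite_vertex_params[OF i] ab in auto)
    then have "{axis_point (\<omega> i) a, axis_point (\<omega> i) b} = ?e (i, a)" by simp
    moreover have "(i, a) \<in> flags" using i ab by (simp add: flags_def)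
    ultimately show ?thesis by blast
  qed
  show ?thesis
  proof
    fix e assume "e \<in> graph_edges M"
    then obtain u v i where e: "e = {u, v}" "u \<in> graph_verts M" "v \<in> graph_verts M" "u \<noteq> v"
      "i < m" "u \<in> seg i" "v \<in> seg i" "graph_verts M \<inter> seg i \<inter> open_segment u v = {}"
      unfolding graph_edges_def buffon_set_def by auto
    then obtain a b where ab: "u = axis_point (\<omega> i) a" "v = axis_point (\<omega> i) b"
      "a \<in> vertex_params i" "b \<in> vertex_params i"
      by (auto simp: seg_image vertex_params_def)
    show "e \<in> ?e ` flags"
    proof (cases "a < b")
      case True
      then show ?thesis using *[of i a b] e ab by auto
    next
      case False
      then have "b < a" using e(4) ab by auto
      moreover have "graph_verts M \<inter> seg i \<inter> open_segment v u = {}"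
        using e(8) by (simp add: open_segment_commute)
      ultimately show ?thesis using *[of i b a] e ab by (simp add: insert_commute)
    qed
  qed
qed

lemma card_graph_edges_le: "card (graph_edges M) \<le> card flags"
  by (meson graph_edges_subset finite_flags surj_card_le)

section \<open>Counting bounded faces by flags and sides\<close>

text \<open>Near a vertex-free piece of a segment, a thin strip on one side avoids all segments; being
  convex, it lies in one face.\<close>

definition strip :: "nat \<Rightarrow> real \<Rightarrow> real set \<Rightarrow> real \<Rightarrow> point set" where
  "strip i \<sigma> T \<delta> = (\<lambda>(t, h). axis_point (\<omega> i) t + (\<sigma> * h) *\<^sub>R normal (\<omega> i)) ` (T \<times> {0<..<\<delta>})"

text \<open>A strip is the image of the convex set \<open>T \<times> {0<..<\<delta>}\<close> under
  an affine map.\<close>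

lemma convex_strip:
  assumes "convex T"
  shows "convex (strip i \<sigma> T \<delta>)"
proof -
  have "linear (\<lambda>x. fst x *\<^sub>R direction (\<omega> i) + (\<sigma> * snd x) *\<^sub>R normal (\<omega> i))"
    by (rule linearI) (auto simp: algebra_simps)
  then have "convex ((\<lambda>x. fst x *\<^sub>R direction (\<omega> i) + (\<sigma> * snd x) *\<^sub>R normal (\<omega> i)) ` (T \<times> {0<..<\<delta>}))"
    by (rule convex_linear_image) (use assms in \<open>auto intro: convex_Times\<close>)
  then have "convex ((+) (fst (\<omega> i)) ` (\<lambda>x. fst x *\<^sub>R direction (\<omega> i) + (\<sigma> * snd x) *\<^sub>R normal (\<omega> i)) ` (T \<times> {0<..<\<delta>}))"
    by (rule convex_translation)
  then show ?thesis
    by (simp add: strip_def image_image axis_point_def case_prod_beta add.assoc)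
qed

text \<open>The piece is compact and avoids the closed union of the other segments, so it has a
  positive distance \<delta> from them. The segment itself is avoided because strip points have a
  nonzero normal offset. The same \<delta> serves both sides.\<close>

lemma strip_disjoint:
  assumes i: "i < m" and T: "{t1..t2} \<subseteq> {-l/2..l/2}" "{t1..t2} \<inter> vertex_params i = {}"
  obtains \<delta> where "\<delta> > 0" "\<And>\<sigma>. \<bar>\<sigma>\<bar> = 1 \<Longrightarrow> strip i \<sigma> {t1..t2} \<delta> \<subseteq> - \<Union>M"
proof -
  let ?K = "\<Union>j\<in>{..<m} - {i}. seg j"
  let ?S = "axis_point (\<omega> i) ` {t1..t2}"
  have "continuous_on {t1..t2} (axis_point (\<omega> i))"
    unfolding axis_point_def by (intro continuous_intros)
  then have "compact ?S" by (rule compact_continuous_image) simp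
  moreover have "closed ?K"
    by (intro closed_UN) (auto simp: placed_segment_eq_closed_segment)
  moreover have "?S \<inter> ?K = {}"
  proof (rule ccontr)
    assume "?S \<inter> ?K \<noteq> {}"
    then obtain t j where t: "t \<in> {t1..t2}" "j < m" "j \<noteq> i" "axis_point (\<omega> i) t \<in> seg j" by blast
    moreover have "axis_point (\<omega> i) t \<in> seg i" using t T unfolding seg_image by blast
    ultimately have "axis_point (\<omega> i) t \<in> graph_verts M"
      unfolding graph_verts_def crossing_points_eq using i by blast
    then show False using t(1) T unfolding vertex_params_def by blast
  qed
  ultimately have "\<exists>\<delta>>0. \<forall>x\<in>?S. \<forall>y\<in>?K. \<delta> \<le> dist x y"
    by (rule separate_compact_closed)
  then obtain \<delta> where \<delta>: "\<delta> > 0" "\<And>x y. x \<in> ?S \<Longrightarrow> y \<in> ?K \<Longrightarrow> \<delta> \<le> dist x y"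
    by metis
  show thesis
  proof (rule that[OF \<delta>(1)])
    fix \<sigma> :: real assume \<sigma>: "\<bar>\<sigma>\<bar> = 1"
    show "strip i \<sigma> {t1..t2} \<delta> \<subseteq> - \<Union>M"
    proof
      fix y assume "y \<in> strip i \<sigma> {t1..t2} \<delta>"
      then obtain t h where th: "t \<in> {t1..t2}" "0 < h" "h < \<delta>"
        and y: "y = axis_point (\<omega> i) t + (\<sigma> * h) *\<^sub>R normal (\<omega> i)"
        unfolding strip_def by auto
      have "dist (axis_point (\<omega> i) t) y = h"
        using \<sigma> th(2) by (simp add: y dist_norm norm_normal abs_mult)
      then have "y \<notin> ?K" using \<delta>(2)[of "axis_point (\<omega> i) t" y] th by force
      moreover have "y \<notin> seg i"
      proof
        assume "y \<in> seg i"
        then obtain t' where "y = axis_point (\<omega> i) t'" unfolding seg_image by blast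
        then have "\<sigma> * h = 0" using y off_axis by metis
        then show False using \<sigma> th by auto
      qed
      ultimately show "y \<in> - \<Union>M" unfolding buffon_set_def by blast
    qed
  qed
qed

lemma strip_subset_face:
  assumes F: "F \<in> components (- \<Union>M)" and "strip i \<sigma> {t1..t2} \<delta> \<subseteq> - \<Union>M" "F \<inter> strip i \<sigma> {t1..t2} \<delta> \<noteq> {}"
  shows "strip i \<sigma> {t1..t2} \<delta> \<subseteq> F"
  using components_maximal[OF F] convex_connected[OF convex_strip] assms(2,3) by (simp add: convex_real_interval)

text \<open>The sign \<sigma> selects a side of segment \<open>i\<close>, and \<open>F\<close>
  contains a short normal needle on that side, based at some \<open>t\<close> on the edge that
  follows the vertex \<open>a\<close>. The base point is existential because a face may be detected
  anywhere along this edge.\<close>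

definition borders :: "point set \<Rightarrow> (nat \<times> real) \<times> real \<Rightarrow> bool" where
  "borders F = (\<lambda>((i, a), \<sigma>). \<exists>t \<epsilon>. a < t \<and> t \<le> l/2 \<and> vertex_params i \<inter> {a<..t} = {} \<and> \<epsilon> > 0 \<and>
     strip i \<sigma> {t} \<epsilon> \<subseteq> F)"

text \<open>Both needles stand on the same vertex-free piece of the segment, on the same side. A
  thin strip over the interval between their base points lies in one face and meets both
  needles.\<close>

lemma borders_unique:
  assumes F: "F \<in> components (- \<Union>M)" "F' \<in> components (- \<Union>M)"
    and fl: "f \<in> flags \<times> {1, -1}" and b: "borders F f" "borders F' f"
  shows "F = F'"
proof -
  obtain i a \<sigma> where f: "f = ((i, a), \<sigma>)" by (metis surj_pair)
  have i: "i < m" and a: "-l/2 \<le> a" and \<sigma>: "\<bar>\<sigma>\<bar> = 1"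
    using fl by (auto simp: f flags_def vertex_params_def)
  obtain t \<epsilon> where t: "a < t" "t \<le> l/2" "vertex_params i \<inter> {a<..t} = {}" "\<epsilon> > 0" "strip i \<sigma> {t} \<epsilon> \<subseteq> F"
    using b(1) unfolding borders_def f by auto
  obtain t' \<epsilon>' where t': "a < t'" "t' \<le> l/2" "vertex_params i \<inter> {a<..t'} = {}" "\<epsilon>' > 0" "strip i \<sigma> {t'} \<epsilon>' \<subseteq> F'"
    using b(2) unfolding borders_def f by auto
  define t1 t2 where "t1 = min t t'" and "t2 = max t t'"
  have "{t1..t2} \<subseteq> {-l/2..l/2}" using t t' a by (auto simp: t1_def t2_def)
  moreover have "{t1..t2} \<inter> vertex_params i = {}" using t(1,3) t'(1,3) by (fastforce simp: t1_def t2_def min_def max_def split: if_splits)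
  ultimately obtain \<delta> where \<delta>: "\<delta> > 0" "strip i \<sigma> {t1..t2} \<delta> \<subseteq> - \<Union>M"
    using strip_disjoint[OF i] \<sigma> by metis
  have meet: "G \<inter> strip i \<sigma> {t1..t2} \<delta> \<noteq> {}"
    if "s \<in> {t1..t2}" "e > 0" "strip i \<sigma> {s} e \<subseteq> G" for s e G
  proof -
    \<comment> \<open>Half the minimum gives a height that is positive and below both the strip
      width and the needle length.\<close>
    define h where "h = min \<delta> e / 2"
    have h: "0 < h" "h < \<delta>" "h < e" using \<delta> that by (auto simp: h_def)
    have "axis_point (\<omega> i) s + (\<sigma> * h) *\<^sub>R normal (\<omega> i) \<in> strip i \<sigma> {s} e \<inter> strip i \<sigma> {t1..t2} \<delta>"
      unfolding strip_def using h that(1) by force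
    then show ?thesis using that(3) by blast
  qed
  have "strip i \<sigma> {t1..t2} \<delta> \<subseteq> F"
    by (rule strip_subset_face[OF F(1) \<delta>(2)], rule meet[OF _ t(4,5)]) (auto simp: t1_def t2_def)
  moreover have "F' \<inter> strip i \<sigma> {t1..t2} \<delta> \<noteq> {}"
    by (rule meet[OF _ t'(4,5)]) (auto simp: t1_def t2_def)
  ultimately have "F \<inter> F' \<noteq> {}" by blast
  then show ?thesis using components_nonoverlap[OF F] by blast
qed

text \<open>The infinite frontier contains a point \<open>q\<close> interior to an edge. Points of
  \<open>F\<close> arbitrarily close to \<open>q\<close> lie in the strip on one of the two sides
  there, and that whole strip then belongs to \<open>F\<close>.\<close>

lemma bounded_face_borders:
  assumes F: "F \<in> bounded_faces M"
  shows "\<exists>f \<in> flags \<times> {1, -1}. borders F f"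
proof -
  have comp: "F \<in> components (- \<Union>M)" and bdd: "bounded F"
    using F by (auto simp: bounded_faces_def)
  have clo: "closed (\<Union>M)"
    unfolding buffon_set_def by (intro closed_Union) (auto simp: placed_segment_eq_closed_segment)
  have "open F" using open_components comp clo by blast
  moreover have "F \<noteq> {}" using comp in_components_nonempty by blast
  ultimately have "infinite (frontier F)"
    using bdd by (intro infinite_frontier_of_bounded) auto
  then have "\<not> frontier F \<subseteq> graph_verts M"
    using finite_subset[OF _ finite_graph_verts] by blast
  then obtain q where q: "q \<in> frontier F" "q \<notin> graph_verts M"
    by blast
  have "q \<in> \<Union>M" using frontier_of_components_closed_complement[OF clo comp] q by blast
  then obtain i where i: "i < m" "q \<in> seg i" unfolding buffon_set_def by blast
  then obtain t where t: "q = axis_point (\<omega> i) t" "t \<in> {-l/2..l/2}" unfolding seg_image by blast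
  have tv: "t \<notin> vertex_params i" using q t by (auto simp: vertex_params_def)
  \<comment> \<open>Both ends are vertices, so \<open>t\<close> lies strictly between them. In
    particular a last vertex before \<open>t\<close> exists, and \<open>Max\<close> below ranges
    over a nonempty set.\<close>
  have ends: "-l/2 \<in> vertex_params i" "l/2 \<in> vertex_params i"
    using i length_pos by (auto simp: vertex_params_def graph_verts_def end_points_eq)
  define a where "a = Max {b \<in> vertex_params i. b < t}"
  have fin: "finite {b \<in> vertex_params i. b < t}" using finite_vertex_params[OF i(1)] by auto
  have "- l/2 < t" "t < l/2" using ends tv t(2) by (auto simp: less_le)
  then have "- l/2 \<in> {b \<in> vertex_params i. b < t}" using ends by blast
  then have a: "a \<in> vertex_params i" "a < t"
    using Max_in[OF fin] unfolding a_def by blast+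
  have am: "vertex_params i \<inter> {a<..t} = {}"
  proof -
    have "b \<le> a" if "b \<in> vertex_params i" "b \<le> t" for b
      unfolding a_def using that tv fin by (intro Max_ge) (auto simp: less_le)
    then show ?thesis by force
  qed
  have "open ({-l/2<..<l/2} - vertex_params i)"
    by (simp add: open_Diff finite_imp_closed finite_vertex_params[OF i(1)])
  moreover have "t \<in> {-l/2<..<l/2} - vertex_params i" using tv \<open>- l/2 < t\<close> \<open>t < l/2\<close> by auto
  ultimately obtain \<rho> where \<rho>: "\<rho> > 0" "cball t \<rho> \<subseteq> {-l/2<..<l/2} - vertex_params i"
    using open_contains_cball by blast
  have cb: "cball t \<rho> = {t-\<rho>..t+\<rho>}" by (simp add: cball_eq_atLeastAtMost)
  obtain \<delta> where \<delta>: "\<delta> > 0" "\<And>\<sigma>. \<bar>\<sigma>\<bar> = 1 \<Longrightarrow> strip i \<sigma> {t-\<rho>..t+\<rho>} \<delta> \<subseteq> - \<Union>M"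
  proof (rule strip_disjoint[OF i(1)])
    show "{t-\<rho>..t+\<rho>} \<subseteq> {-l/2..l/2}" "{t-\<rho>..t+\<rho>} \<inter> vertex_params i = {}"
      using \<rho>(2) unfolding cb by fastforce+
  qed blast
  have "q \<in> closure F" using q(1) by (simp add: frontier_def)
  \<comment> \<open>Closeness below \<rho> keeps the axis coordinate inside the vertex-free
    interval; closeness below \<delta> keeps the normal offset within the strip width.\<close>
  then obtain y where y: "y \<in> F" "dist y q < min \<rho> \<delta>"
    using closure_approachable[of q F] \<rho>(1) \<delta>(1) by (meson min_less_iff_conj)
  obtain s h where sh: "y = axis_point (\<omega> i) t + s *\<^sub>R direction (\<omega> i) + h *\<^sub>R normal (\<omega> i)"
    "\<bar>s\<bar> \<le> dist y q" "\<bar>h\<bar> \<le> dist y q"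
    unfolding t(1) by (rule axis_coordinates)
  then have y': "y = axis_point (\<omega> i) (t + s) + h *\<^sub>R normal (\<omega> i)"
    by (simp add: axis_point_def algebra_simps)
  have ts: "t + s \<in> {t-\<rho>..t+\<rho>}" using sh y by auto
  \<comment> \<open>With zero offset \<open>y\<close> would lie on the segment, outside every face.
    The sign of \<open>h\<close> then tells the side.\<close>
  have "h \<noteq> 0"
  proof
    assume "h = 0"
    then have "y = axis_point (\<omega> i) (t + s)" using y' by simp
    moreover have "t + s \<in> {-l/2..l/2}" using ts \<rho>(2) unfolding cb by fastforce
    ultimately have "y \<in> seg i" unfolding seg_image by blast
    then have "y \<in> \<Union>M" using i unfolding buffon_set_def by blast
    then show False using y(1) in_components_subset[OF comp] by blast
  qed
  then have \<sigma>: "\<bar>sgn h\<bar> = 1" by (simp add: abs_sgn_eq)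
  have "y = axis_point (\<omega> i) (t + s) + (sgn h * \<bar>h\<bar>) *\<^sub>R normal (\<omega> i)"
    using y' by (simp add: sgn_mult_abs)
  moreover have "\<bar>h\<bar> \<in> {0<..<\<delta>}" using sh y \<open>h \<noteq> 0\<close> by auto
  ultimately have "y \<in> strip i (sgn h) {t-\<rho>..t+\<rho>} \<delta>"
    unfolding strip_def using ts by force
  then have "strip i (sgn h) {t-\<rho>..t+\<rho>} \<delta> \<subseteq> F"
    using strip_subset_face[OF comp \<delta>(2)[OF \<sigma>]] y(1) by blast
  moreover have "strip i (sgn h) {t} \<delta> \<subseteq> strip i (sgn h) {t-\<rho>..t+\<rho>} \<delta>"
    unfolding strip_def using \<rho>(1) by (intro image_mono Sigma_mono) auto
  ultimately have "borders F ((i, a), sgn h)"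
    unfolding borders_def using a(2) am \<delta>(1) t(2) by auto
  moreover have "((i, a), sgn h) \<in> flags \<times> {1, -1}"
    using i a \<open>h \<noteq> 0\<close> by (auto simp: flags_def sgn_if)
  ultimately show ?thesis by blast
qed

text \<open>By the two preceding lemmas, every bounded face is related to some flag with a side, and
  no flag with a side to two faces. The factor 2 counts the sides.\<close>

lemma card_bounded_faces_le: "card (bounded_faces M) \<le> 2 * card flags"
proof -
  have "card (bounded_faces M) \<le> card (flags \<times> {1, -1::real})"
  proof (rule card_le_if_inj_on_rel[where r = borders])
    show "F = F'" if "F \<in> bounded_faces M" "F' \<in> bounded_faces M" "f \<in> flags \<times> {1, -1}"
      "borders F f" "borders F' f" for F F' f
      using borders_unique[of F F' f] that by (simp add: bounded_faces_def)
    show "\<exists>f. f \<in> flags \<times> {1, -1} \<and> borders F f" if "F \<in> bounded_faces M" for F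
      using bounded_face_borders[OF that] by blast
  qed (use finite_flags in auto)
  then show ?thesis by (simp add: card_cartesian_product)
qed

text \<open>The factor 4 is one flag count for vertices, one for edges and two for bounded
  faces.\<close>

lemma complexity_le: "complexity M \<le> 4 * (\<Sum>i<m. 2 + card (neighbours i))"
  unfolding complexity_def
  using card_graph_verts_le card_graph_edges_le card_bounded_faces_le card_flags by linarith

section \<open>Lower bound by counting vertices\<close>

text \<open>Without triple points a crossing determines its pair, so the pairs number at most
  \<open>card (graph_verts M)\<close>. Each point is the end \<open>l/2\<close> of at most two
  segments, so \<open>m\<close> is at most twice that number. Together this gives the factor
  3.\<close>

lemma complexity_lower:
  assumes simple: "\<And>i j k x. i < m \<Longrightarrow> j < m \<Longrightarrow> k < m \<Longrightarrow> i \<noteq> j \<Longrightarrow> i \<noteq> k \<Longrightarrow> j \<noteq> k \<Longrightarrow>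
      x \<in> seg i \<Longrightarrow> x \<in> seg j \<Longrightarrow> x \<notin> seg k"
  shows "(\<Sum>i<m. card {j \<in> neighbours i. i < j}) + m \<le> 3 * complexity M"
proof -
  let ?P = "SIGMA i:{..<m}. {j \<in> neighbours i. i < j}"
  have finN: "finite {j \<in> neighbours i. i < j}" for i by (simp add: neighbours_def)
  have "card ?P \<le> card (graph_verts M)"
  proof (rule card_le_if_inj_on_rel[where r = "\<lambda>p x. x \<in> seg (fst p) \<inter> seg (snd p)"])
    fix p assume p: "p \<in> ?P"
    then obtain x where "x \<in> seg (fst p) \<inter> seg (snd p)" unfolding neighbours_def by fastforce
    moreover have "fst p < m" "snd p < m" "fst p \<noteq> snd p" using p by (auto simp: neighbours_def)
    ultimately have "x \<in> graph_verts M" "x \<in> seg (fst p) \<inter> seg (snd p)"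
      unfolding graph_verts_def crossing_points_eq by blast+
    then show "\<exists>x. x \<in> graph_verts M \<and> x \<in> seg (fst p) \<inter> seg (snd p)"
      by blast
  next
    fix p q x assume "p \<in> ?P" "q \<in> ?P" "x \<in> graph_verts M"
      "x \<in> seg (fst p) \<inter> seg (snd p)" "x \<in> seg (fst q) \<inter> seg (snd q)"
    moreover obtain i j i' j' where "p = (i, j)" "q = (i', j')" by (metis surj_pair)
    ultimately have *: "i < m" "j < m" "i < j" "i' < m" "j' < m" "i' < j'"
      "x \<in> seg i" "x \<in> seg j" "x \<in> seg i'" "x \<in> seg j'" and pq: "p = (i, j)" "q = (i', j')"
      by (auto simp: neighbours_def)
    have "k = i \<or> k = j" if "k < m" "x \<in> seg k" for k
      using simple[of i j k x] * that by auto
    from this[of i'] this[of j'] * show "p = q" unfolding pq by auto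
  qed (rule finite_graph_verts)
  moreover have "card ?P = (\<Sum>i<m. card {j \<in> neighbours i. i < j})"
    by (simp add: card_SigmaI finN)
  moreover have "m \<le> 2 * card (graph_verts M)"
  proof -
    let ?e = "\<lambda>i. axis_point (\<omega> i) (l/2)"
    have sub: "?e ` {..<m} \<subseteq> graph_verts M" by (auto simp: graph_verts_def end_points_eq)
    have two: "card {i. i < m \<and> ?e i = x} \<le> 2" for x
    proof (rule ccontr)
      assume "\<not> card {i. i < m \<and> ?e i = x} \<le> 2"
      then have "Suc (Suc (Suc 0)) \<le> card {i. i < m \<and> ?e i = x}" by simp
      then obtain i j k where "i \<noteq> j" "i \<noteq> k" "j \<noteq> k" "{i, j, k} \<subseteq> {i. i < m \<and> ?e i = x}"
        unfolding card_le_Suc_iff by auto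
      moreover from this have "x \<in> seg i" "x \<in> seg j" "x \<in> seg k"
        using ends_in_seg(2)[of i] ends_in_seg(2)[of j] ends_in_seg(2)[of k]
        by auto
      ultimately show False using simple[of i j k x] by auto
    qed
    \<comment> \<open>The index set is the union of the fibres of the end-point map, each of size at
      most 2.\<close>
    have "m = card (\<Union>x\<in>?e ` {..<m}. {i. i < m \<and> ?e i = x})"
      by (subst arg_cong[where f = card, of _ "{..<m}"]) auto
    also have "\<dots> \<le> (\<Sum>x\<in>?e ` {..<m}. card {i. i < m \<and> ?e i = x})" by (rule card_UN_le) simp
    also have "\<dots> \<le> (\<Sum>x\<in>?e ` {..<m}. 2)" by (intro sum_mono two)
    also have "\<dots> \<le> 2 * card (graph_verts M)"
      using card_mono[OF finite_graph_verts sub] by simp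
    finally show ?thesis .
  qed
  ultimately have "(\<Sum>i<m. card {j \<in> neighbours i. i < j}) + m \<le> card (graph_verts M) + 2 * card (graph_verts M)"
    by (intro add_mono) auto
  also have "\<dots> \<le> 3 * complexity M" by (simp add: complexity_def)
  finally show ?thesis .
qed

end

section \<open>Random placements\<close>

lemma emeasure_lborel_rect:
  fixes a b c d :: real
  assumes "a \<le> b" "c \<le> d"
  shows "emeasure lborel ({a..b} \<times> {c..d}) = ennreal ((b - a) * (d - c))"
proof -
  have "emeasure lborel ({a..b} \<times> {c..d}) = emeasure (lborel \<Otimes>\<^sub>M lborel) ({a..b} \<times> {c..d})"
    by (simp add: lborel_prod)
  also have "\<dots> = emeasure lborel {a..b} * emeasure lborel {c..d}"
    by (rule lborel.emeasure_pair_measure_Times) auto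
  finally show ?thesis using assms by (simp add: ennreal_mult)
qed

abbreviation unit_square :: "point set" where
  "unit_square \<equiv> {0..1} \<times> {0..1}"

lemma borel_rect [measurable]:
  fixes a b c d :: real
  shows "{a..b} \<times> {c..d} \<in> sets borel"
  by (intro borel_Times) auto

lemma prob_space_uniform_square: "prob_space (uniform_measure lborel unit_square)"
  by (rule prob_space_uniform_measure) (simp_all add: emeasure_lborel_rect)

lemma prob_space_uniform_angle: "prob_space (uniform_measure lborel {0..<pi})"
  by (rule prob_space_uniform_measure) simp_all

interpretation placement: pair_prob_space "uniform_measure lborel unit_square" "uniform_measure lborel {0..<pi}"
  by (intro pair_prob_space.intro pair_sigma_finite.intro prob_space_uniform_square prob_space_uniform_angle
      prob_space_imp_sigma_finite)

lemma prob_space_placement: "prob_space placement_measure"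
  unfolding placement_measure_def by (rule placement.prob_space_axioms)

lemma sets_placement [measurable_cong]:
  "sets placement_measure = sets (borel \<Otimes>\<^sub>M borel)"
  unfolding placement_measure_def by (intro sets_pair_measure_cong) simp_all

lemma space_placement [simp]: "space placement_measure = UNIV"
  by (simp add: placement_measure_def space_pair_measure)

interpretation buffon: product_prob_space "\<lambda>_. placement_measure" I for I
  by (intro product_prob_spaceI prob_space_placement)

section \<open>Null events for a single placement\<close>

lemma AE_uniform_countable:
  assumes "countable (C :: 'a::euclidean_space set)" "A \<in> sets lborel"
  shows "AE x in uniform_measure lborel A. x \<notin> C"
proof (rule AE_uniform_measureI[OF assms(2)])
  have "AE x in lborel. x \<notin> C"
    using AE_not_in[OF countable_imp_null_set_lborel[OF assms(1)]] .
  then show "AE x in lborel. x \<in> A \<longrightarrow> x \<notin> C" by eventually_elim simp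
qed

lemma countable_sin_diff_zeros: "countable {\<theta>::real. sin (\<theta> - a) = 0}"
proof -
  have "{\<theta>. sin (\<theta> - a) = 0} \<subseteq> range (\<lambda>n::int. of_int n * pi + a)"
    by (auto simp: sin_zero_iff_int2 image_iff algebra_simps)
  then show ?thesis by (rule countable_subset) simp
qed

text \<open>Any two angles parallel to the same nonzero vector differ by a zero of the sine.\<close>

lemma countable_parallel_angles:
  fixes v :: point
  assumes "v \<noteq> 0"
  shows "countable {\<theta>. cross v (cos \<theta>, sin \<theta>) = 0}"
proof (cases "{\<theta>. cross v (cos \<theta>, sin \<theta>) = 0} = {}")
  case False
  then obtain \<theta>0 where \<theta>0: "cross v (cos \<theta>0, sin \<theta>0) = 0" by blast
  have "sin (\<theta> - \<theta>0) = 0" if "cross v (cos \<theta>, sin \<theta>) = 0" for \<theta>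
  proof -
    have "fst v * sin \<theta> = snd v * cos \<theta>" "fst v * sin \<theta>0 = snd v * cos \<theta>0"
      using that \<theta>0 by (auto simp: cross_def)
    then have "fst v * sin (\<theta> - \<theta>0) = 0" "snd v * sin (\<theta> - \<theta>0) = 0"
      unfolding sin_diff by algebra+
    then show ?thesis using assms by (auto simp: prod_eq_iff)
  qed
  then show ?thesis
    by (intro countable_subset[OF _ countable_sin_diff_zeros[of \<theta>0]]) auto
qed simp

lemma borel_measurable_point_components [measurable]:
  "fst \<in> borel_measurable (borel :: point measure)" "snd \<in> borel_measurable (borel :: point measure)"
  by (auto intro!: borel_measurable_continuous_onI continuous_intros)

lemma measurable_cross [measurable]:
  assumes [measurable]: "f \<in> borel_measurable M" "g \<in> borel_measurable M"
  shows "(\<lambda>x. cross (f x) (g x)) \<in> borel_measurable M"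
  unfolding cross_def by measurable

lemma measurable_direction [measurable]: "direction \<in> borel_measurable (borel \<Otimes>\<^sub>M borel)"
  unfolding direction_def by measurable

lemma AE_placement_transversal: "AE p in placement_measure. sin (snd p - a) \<noteq> 0"
  unfolding placement_measure_def
proof (rule placement.AE_pair_measure)
  show "AE c in uniform_measure lborel unit_square. AE \<theta> in uniform_measure lborel {0..<pi}. sin (snd (c, \<theta>) - a) \<noteq> 0"
    using AE_uniform_countable[OF countable_sin_diff_zeros, of "{0..<pi}" a] by (auto intro!: AE_I2)
qed measurable

text \<open>The supporting line of a random segment misses a fixed point \<open>x\<close>: almost
  surely the center differs from \<open>x\<close>, and then only countably many angles point along
  \<open>c - x\<close>.\<close>

lemma AE_placement_misses: "AE p in placement_measure. cross (fst p - x) (direction p) \<noteq> 0"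
  unfolding placement_measure_def
proof (rule placement.AE_pair_measure)
  have "AE c in uniform_measure lborel unit_square. c \<notin> {x}"
    by (rule AE_uniform_countable) auto
  then show "AE c in uniform_measure lborel unit_square. AE \<theta> in uniform_measure lborel {0..<pi}.
      cross (fst (c, \<theta>) - x) (direction (c, \<theta>)) \<noteq> 0"
  proof eventually_elim
    case (elim c)
    then show ?case
      using AE_uniform_countable[OF countable_parallel_angles, of "c - x" "{0..<pi}"]
      by (simp add: direction_def)
  qed
qed measurable

lemma AE_placement_range: "AE p in placement_measure. fst p \<in> unit_square \<and> snd p \<in> {0..<pi}"
  unfolding placement_measure_def
proof (rule placement.AE_pair_measure)
  have "AE c in uniform_measure lborel unit_square. c \<in> unit_square"
    by (rule AE_uniform_measureI) auto
  moreover have "AE \<theta> in uniform_measure lborel {0..<pi}. \<theta> \<in> {0..<pi}"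
    by (rule AE_uniform_measureI) auto
  ultimately show "AE c in uniform_measure lborel unit_square. AE \<theta> in uniform_measure lborel {0..<pi}.
      fst (c, \<theta>) \<in> unit_square \<and> snd (c, \<theta>) \<in> {0..<pi}"
    by (auto elim: AE_mp intro!: AE_I2)
qed measurable

section \<open>Probability estimates for a single placement\<close>

lemma emeasure_placement_Times:
  assumes "A \<in> sets borel" "B \<in> sets borel" "A \<subseteq> unit_square" "B \<subseteq> {0..<pi}"
  shows "emeasure placement_measure (A \<times> B) = emeasure lborel A * (emeasure lborel B / ennreal pi)"
  unfolding placement_measure_def using assms
  by (subst placement.M2.emeasure_pair_measure_Times)
     (auto simp: emeasure_lborel_rect Int_absorb1 divide_ennreal_def inverse_eq_divide)

lemma emeasure_placement_near_le:
  assumes "r \<ge> 0"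
  shows "emeasure placement_measure {p. \<bar>fst (fst p) - a\<bar> \<le> r \<and> \<bar>snd (fst p) - b\<bar> \<le> r} \<le> ennreal (4 * r\<^sup>2)"
proof -
  let ?S = "{a-r..a+r} \<times> {b-r..b+r}"
  have "{p::point \<times> real. \<bar>fst (fst p) - a\<bar> \<le> r \<and> \<bar>snd (fst p) - b\<bar> \<le> r} = ?S \<times> UNIV"
    by (auto simp: abs_le_iff)
  then have "emeasure placement_measure {p. \<bar>fst (fst p) - a\<bar> \<le> r \<and> \<bar>snd (fst p) - b\<bar> \<le> r}
      = emeasure (uniform_measure lborel unit_square) ?S * emeasure (uniform_measure lborel {0..<pi}) UNIV"
    unfolding placement_measure_def by (simp add: placement.M2.emeasure_pair_measure_Times)
  also have "\<dots> = emeasure lborel (unit_square \<inter> ?S)"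
    using placement.M2.emeasure_space_1 by (simp add: emeasure_lborel_rect divide_ennreal_def)
  also have "\<dots> \<le> emeasure lborel ?S" by (intro emeasure_mono) auto
  also have "\<dots> = ennreal (4 * r\<^sup>2)"
    using assms by (simp add: emeasure_lborel_rect power2_eq_square algebra_simps)
  finally show ?thesis .
qed

text \<open>The event contains a box: a square of side \<open>r\<close> inside the unit square for
  the center, and an interval of length \<open>pi/6\<close> for the angle. The latter has
  probability 1/6.\<close>

lemma emeasure_placement_crossing_ge:
  assumes c: "c \<in> unit_square" and \<theta>: "\<theta> \<in> {0..<pi}" and r: "0 < r" "r \<le> 1/2"
  shows "ennreal (r\<^sup>2 / 6) \<le> emeasure placement_measure
    {p. \<bar>fst (fst p) - fst c\<bar> \<le> r \<and> \<bar>snd (fst p) - snd c\<bar> \<le> r \<and> 1/2 \<le> \<bar>sin (snd p - \<theta>)\<bar>}"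
proof -
  \<comment> \<open>The interval extends from \<open>x\<close> towards the middle of the unit
    interval; \<open>r \<le> 1/2\<close> keeps it inside.\<close>
  have sub: "\<exists>u. {u..u+r} \<subseteq> {0..1} \<and> (\<forall>z\<in>{u..u+r}. \<bar>z - x\<bar> \<le> r)" if "x \<in> {0..1}" for x :: real
  proof (cases "x \<le> 1/2")
    case True then show ?thesis using that r by (intro exI[of _ x]) auto
  next
    case False then show ?thesis using that r by (intro exI[of _ "x - r"]) auto
  qed
  obtain u where u: "{u..u+r} \<subseteq> {0..1}" "\<forall>z\<in>{u..u+r}. \<bar>z - fst c\<bar> \<le> r"
    using sub[of "fst c"] c by (cases c) auto
  obtain v where v: "{v..v+r} \<subseteq> {0..1}" "\<forall>z\<in>{v..v+r}. \<bar>z - snd c\<bar> \<le> r"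
    using sub[of "snd c"] c by (cases c) auto
  have sin_ge: "1/2 \<le> sin x" if "pi/6 \<le> x" "x \<le> pi/3" for x
    using sin_monotone_2pi_le[of "pi/6" x] that pi_gt_zero by (simp add: sin_30)
  \<comment> \<open>The angles differ from \<theta> by between \<open>pi/6\<close> and
    \<open>pi/3\<close>. They are taken above \<theta> in the first half of the range and below it
    in the second, so that they stay in \<open>{0..<pi}\<close>.\<close>
  obtain w where w: "{w..w+pi/6} \<subseteq> {0..<pi}" "\<forall>z\<in>{w..w+pi/6}. 1/2 \<le> \<bar>sin (z - \<theta>)\<bar>"
  proof (cases "\<theta> \<le> pi/2")
    case True
    show thesis
    proof (rule that[of "\<theta> + pi/6"])
      show "{\<theta> + pi/6..\<theta> + pi/6 + pi/6} \<subseteq> {0..<pi}" 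
      proof
        fix z assume "z \<in> {\<theta> + pi/6..\<theta> + pi/6 + pi/6}"
        then have "0 \<le> z \<and> z \<le> pi/2 + pi/3" using \<theta> True by auto
        moreover have "pi/2 + pi/3 < pi" by simp
        ultimately show "z \<in> {0..<pi}" by (meson atLeastLessThan_iff order_le_less_trans)
      qed
      show "\<forall>z\<in>{\<theta> + pi/6..\<theta> + pi/6 + pi/6}. 1/2 \<le> \<bar>sin (z - \<theta>)\<bar>"
      proof
        fix z assume "z \<in> {\<theta> + pi/6..\<theta> + pi/6 + pi/6}"
        then have "1/2 \<le> sin (z - \<theta>)" by (intro sin_ge) auto
        then show "1/2 \<le> \<bar>sin (z - \<theta>)\<bar>" by linarith
      qed
    qed
  next
    case False
    show thesis
    proof (rule that[of "\<theta> - pi/3"])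
      show "{\<theta> - pi/3..\<theta> - pi/3 + pi/6} \<subseteq> {0..<pi}" using \<theta> False pi_gt_zero by auto
      show "\<forall>z\<in>{\<theta> - pi/3..\<theta> - pi/3 + pi/6}. 1/2 \<le> \<bar>sin (z - \<theta>)\<bar>"
      proof
        fix z assume "z \<in> {\<theta> - pi/3..\<theta> - pi/3 + pi/6}"
        then have "1/2 \<le> sin (\<theta> - z)" by (intro sin_ge) auto
        also have "sin (\<theta> - z) = - sin (z - \<theta>)" using sin_minus[of "z - \<theta>"] by simp
        finally show "1/2 \<le> \<bar>sin (z - \<theta>)\<bar>" by linarith
      qed
    qed
  qed
  let ?R = "({u..u+r} \<times> {v..v+r}) \<times> {w..w+pi/6}"
  have "emeasure placement_measure ?R
      = emeasure lborel ({u..u+r} \<times> {v..v+r}) * (emeasure lborel {w..w+pi/6} / ennreal pi)"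
    using u(1) v(1) w(1) by (intro emeasure_placement_Times) auto
  also have "\<dots> = ennreal (r * r) * (ennreal (pi/6) / ennreal pi)"
    using r by (simp add: emeasure_lborel_rect)
  also have "\<dots> = ennreal (r\<^sup>2 / 6)"
    using r by (simp add: divide_ennreal power2_eq_square flip: ennreal_mult)
  finally have "ennreal (r\<^sup>2 / 6) = emeasure placement_measure ?R" by simp
  also have "\<dots> \<le> emeasure placement_measure
    {p. \<bar>fst (fst p) - fst c\<bar> \<le> r \<and> \<bar>snd (fst p) - snd c\<bar> \<le> r \<and> 1/2 \<le> \<bar>sin (snd p - \<theta>)\<bar>}"
  proof (rule emeasure_mono)
    show "?R \<subseteq> {p. \<bar>fst (fst p) - fst c\<bar> \<le> r \<and> \<bar>snd (fst p) - snd c\<bar> \<le> r \<and> 1/2 \<le> \<bar>sin (snd p - \<theta>)\<bar>}"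
      using u(2) v(2) w(2) by force
    have "{p \<in> space (borel \<Otimes>\<^sub>M borel). \<bar>fst (fst p) - fst c\<bar> \<le> r \<and> \<bar>snd (fst p) - snd c\<bar> \<le> r \<and> 1/2 \<le> \<bar>sin (snd p - \<theta>)\<bar>}
      \<in> sets (borel \<Otimes>\<^sub>M borel)" by measurable
    then show "{p. \<bar>fst (fst p) - fst c\<bar> \<le> r \<and> \<bar>snd (fst p) - snd c\<bar> \<le> r \<and> 1/2 \<le> \<bar>sin (snd p - \<theta>)\<bar>}
      \<in> sets placement_measure" by (simp add: sets_placement space_pair_measure)
  qed
  finally show ?thesis .
qed

section \<open>Resampling one segment\<close>

lemma nn_integral_buffon_space:
  assumes "j < m" "f \<in> borel_measurable (buffon_space m)"
  shows "(\<integral>\<^sup>+ \<omega>. f \<omega> \<partial>buffon_space m)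
    = (\<integral>\<^sup>+ x. (\<integral>\<^sup>+ p. f (x(j := p)) \<partial>placement_measure) \<partial>Pi\<^sub>M ({..<m} - {j}) (\<lambda>_. placement_measure))"
proof -
  have "insert j ({..<m} - {j}) = {..<m}" using assms by auto
  then show ?thesis
    using buffon.product_nn_integral_insert[of "{..<m} - {j}" j f] assms(2)
    by (simp add: buffon_space_def)
qed

text \<open>Integrating the indicator of the exceptional set over coordinate \<open>j\<close> first
  gives 0 for every choice of the other coordinates.\<close>

lemma AE_buffon_space:
  assumes "j < m" and [measurable]: "Measurable.pred (buffon_space m) P"
    and "\<And>x. AE p in placement_measure. P (x(j := p))"
  shows "AE \<omega> in buffon_space m. P \<omega>"
proof (rule AE_I')
  have m: "{\<omega> \<in> space (buffon_space m). \<not> P \<omega>} \<in> sets (buffon_space m)" by measurable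
  have "emeasure (buffon_space m) {\<omega> \<in> space (buffon_space m). \<not> P \<omega>}
    = (\<integral>\<^sup>+ \<omega>. indicator {\<omega> \<in> space (buffon_space m). \<not> P \<omega>} \<omega> \<partial>buffon_space m)"
    using m by simp
  also have "\<dots> = (\<integral>\<^sup>+ x. (\<integral>\<^sup>+ p. indicator {\<omega> \<in> space (buffon_space m). \<not> P \<omega>} (x(j := p)) \<partial>placement_measure)
      \<partial>Pi\<^sub>M ({..<m} - {j}) (\<lambda>_. placement_measure))"
    by (rule nn_integral_buffon_space[OF assms(1)]) (use m in measurable)
  also have "\<dots> = (\<integral>\<^sup>+ x. (\<integral>\<^sup>+ p. 0 \<partial>placement_measure) \<partial>Pi\<^sub>M ({..<m} - {j}) (\<lambda>_. placement_measure))"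
  proof (rule nn_integral_cong, rule nn_integral_cong_AE)
    fix x
    show "AE p in placement_measure. indicator {\<omega> \<in> space (buffon_space m). \<not> P \<omega>} (x(j := p)) = (0::ennreal)"
      using assms(3)[of x] by eventually_elim (simp add: indicator_def)
  qed
  finally show "{\<omega> \<in> space (buffon_space m). \<not> P \<omega>} \<in> null_sets (buffon_space m)"
    using m by (simp add: null_sets_def)
qed auto

text \<open>The distance of the centers is measured coordinatewise, so that the event is a box for
  the product measure.\<close>

definition near :: "real \<Rightarrow> point \<times> real \<Rightarrow> point \<times> real \<Rightarrow> bool" where
  "near r p q \<longleftrightarrow> \<bar>fst (fst q) - fst (fst p)\<bar> \<le> r \<and> \<bar>snd (fst q) - snd (fst p)\<bar> \<le> r"

definition well_crossing :: "real \<Rightarrow> point \<times> real \<Rightarrow> point \<times> real \<Rightarrow> bool" where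
  "well_crossing r p q \<longleftrightarrow> near r p q \<and> 1/2 \<le> \<bar>sin (snd q - snd p)\<bar>"

text \<open>Cramer's rule for the common point of two supporting lines. For parallel lines the
  division by zero gives 0 and the value is \<open>fst p\<close>; this keeps the function total and
  measurable.\<close>

definition axes_intersection :: "point \<times> real \<Rightarrow> point \<times> real \<Rightarrow> point" where
  "axes_intersection p q =
     axis_point p (cross (fst q - fst p) (direction q) / cross (direction p) (direction q))"

lemma measurable_near [measurable]:
  assumes [measurable]: "f \<in> N \<rightarrow>\<^sub>M borel \<Otimes>\<^sub>M borel" "g \<in> N \<rightarrow>\<^sub>M borel \<Otimes>\<^sub>M borel"
  shows "Measurable.pred N (\<lambda>x. near r (f x) (g x))"
  unfolding near_def by measurable

lemma measurable_well_crossing [measurable]: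
  assumes [measurable]: "f \<in> N \<rightarrow>\<^sub>M borel \<Otimes>\<^sub>M borel" "g \<in> N \<rightarrow>\<^sub>M borel \<Otimes>\<^sub>M borel"
  shows "Measurable.pred N (\<lambda>x. well_crossing r (f x) (g x))"
  unfolding well_crossing_def by measurable

lemma measurable_axes_intersection [measurable]:
  assumes [measurable]: "f \<in> N \<rightarrow>\<^sub>M borel \<Otimes>\<^sub>M borel" "g \<in> N \<rightarrow>\<^sub>M borel \<Otimes>\<^sub>M borel"
  shows "(\<lambda>x. axes_intersection (f x) (g x)) \<in> borel_measurable N"
  unfolding axes_intersection_def axis_point_def by measurable

lemma measurable_placement_component [measurable]:
  "i < m \<Longrightarrow> (\<lambda>\<omega>. \<omega> i) \<in> buffon_space m \<rightarrow>\<^sub>M borel \<Otimes>\<^sub>M borel"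
  unfolding buffon_space_def
  using measurable_component_singleton[of i "{..<m}" "\<lambda>_. placement_measure"]
  by (simp cong: measurable_cong_sets add: sets_placement)

text \<open>The difference of the centers is a combination of two unit vectors with coefficients at
  most \<open>l/2\<close> in absolute value.\<close>

lemma near_of_placed_segments_meet:
  assumes "l > 0" "placed_segment l p \<inter> placed_segment l q \<noteq> {}"
  shows "near l p q"
proof -
  obtain s t where st: "\<bar>s\<bar> \<le> l/2" "\<bar>t\<bar> \<le> l/2" "axis_point p s = axis_point q t"
  proof -
    obtain s t where "s \<in> {-l/2..l/2}" "t \<in> {-l/2..l/2}" "axis_point p s = axis_point q t"
      using assms(2) unfolding placed_segment_eq_image[OF assms(1)] by blast
    then show thesis by (intro that[of s t]) (auto simp: abs_le_iff)
  qed
  then have e: "fst q - fst p = s *\<^sub>R direction p - t *\<^sub>R direction q"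
    by (simp add: axis_point_def algebra_simps)
  have bound: "\<bar>s * x - t * y\<bar> \<le> l" if "\<bar>x\<bar> \<le> 1" "\<bar>y\<bar> \<le> 1" for x y
  proof -
    have "\<bar>s * x\<bar> \<le> l/2 * 1" "\<bar>t * y\<bar> \<le> l/2 * 1"
      unfolding abs_mult using st that assms(1) by (intro mult_mono; simp)+
    then show ?thesis by linarith
  qed
  have "fst (fst q) - fst (fst p) = s * cos (snd p) - t * cos (snd q)"
    "snd (fst q) - snd (fst p) = s * sin (snd p) - t * sin (snd q)"
    using arg_cong[OF e, of fst] arg_cong[OF e, of snd] by (simp_all add: direction_def)
  then show ?thesis unfolding near_def using bound by simp
qed

text \<open>Cramer's rule gives the parameters of the crossing of the axes. The numerators are at
  most \<open>l/8 + l/8 = l/4\<close> and the determinant is at least 1/2, so both parameters are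
  within \<open>l/2\<close>.\<close>

lemma placed_segments_meet_of_well_crossing:
  assumes "l > 0" "well_crossing (l/8) p q"
  shows "placed_segment l p \<inter> placed_segment l q \<noteq> {}"
proof -
  define d where "d = fst q - fst p"
  define D where "D = cross (direction p) (direction q)"
  have D: "1/2 \<le> \<bar>D\<bar>" using assms by (simp add: D_def cross_direction well_crossing_def)
  have d: "\<bar>fst d\<bar> \<le> l/8" "\<bar>snd d\<bar> \<le> l/8"
    using assms by (auto simp: d_def well_crossing_def near_def)
  define s t where "s = cross d (direction q) / D" and "t = cross d (direction p) / D"
  have bound: "\<bar>cross d (direction r) / D\<bar> \<le> l/2" for r
  proof -
    have "\<bar>fst d * sin (snd r)\<bar> \<le> l/8 * 1" "\<bar>snd d * cos (snd r)\<bar> \<le> l/8 * 1"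
      unfolding abs_mult using d assms(1) by (intro mult_mono; simp)+
    then have "\<bar>cross d (direction r)\<bar> \<le> l/4"
      unfolding cross_def direction_def fst_conv snd_conv by linarith
    also have "l/4 \<le> l/2 * \<bar>D\<bar>" using D assms(1) mult_left_mono[of "1/2" "\<bar>D\<bar>" "l/2"] by simp
    finally show ?thesis using D by (simp add: abs_divide pos_divide_le_eq)
  qed
  have "axis_point p s = axis_point q t"
  proof -
    have "D \<noteq> 0" using D by auto
    have "D *\<^sub>R d = cross d (direction q) *\<^sub>R direction p - cross d (direction p) *\<^sub>R direction q"
      by (rule prod_eqI) (simp_all add: D_def cross_def algebra_simps)
    then have "inverse D *\<^sub>R (D *\<^sub>R d) = inverse D *\<^sub>R (cross d (direction q) *\<^sub>R direction p - cross d (direction p) *\<^sub>R direction q)"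
      by simp
    then have "d = s *\<^sub>R direction p - t *\<^sub>R direction q"
      using \<open>D \<noteq> 0\<close> by (simp add: s_def t_def scaleR_diff_right divide_inverse mult.commute)
    then show ?thesis by (simp add: d_def axis_point_def algebra_simps)
  qed
  moreover have "\<bar>s\<bar> \<le> l/2" "\<bar>t\<bar> \<le> l/2"
    using bound[of q] bound[of p] unfolding s_def t_def by blast+
  then have "s \<in> {-l/2..l/2}" "t \<in> {-l/2..l/2}"
    by (auto simp: abs_le_iff)
  ultimately show ?thesis
    unfolding placed_segment_eq_image[OF assms(1)] by blast
qed

text \<open>Taking \<open>cross\<close> with \<open>direction q\<close> eliminates \<open>t\<close>
  and determines \<open>s\<close>.\<close>

lemma axes_intersection_unique:
  assumes "sin (snd p - snd q) \<noteq> 0" "axis_point p s = axis_point q t"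
  shows "axis_point p s = axes_intersection p q"
proof -
  have "cross (direction p) (direction q) \<noteq> 0"
    using assms(1) sin_minus[of "snd p - snd q"] by (simp add: cross_direction)
  moreover have e: "fst q - fst p = s *\<^sub>R direction p - t *\<^sub>R direction q"
    using assms(2) by (simp add: axis_point_def algebra_simps)
  have "cross (fst q - fst p) (direction q) = s * cross (direction p) (direction q)"
    unfolding e by (simp add: cross_def algebra_simps)
  ultimately show ?thesis by (simp add: axes_intersection_def)
qed

lemma cross_axis_point: "cross (fst p - axis_point p t) (direction p) = 0"
  by (simp add: axis_point_def cross_def)

section \<open>Almost sure general position\<close>

lemma AE_transversal:
  "AE \<omega> in buffon_space m. \<forall>i j. i < m \<longrightarrow> j < m \<longrightarrow> i \<noteq> j \<longrightarrow> sin (snd (\<omega> i) - snd (\<omega> j)) \<noteq> 0"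
  unfolding AE_all_countable
proof (intro allI)
  fix i j
  show "AE \<omega> in buffon_space m. i < m \<longrightarrow> j < m \<longrightarrow> i \<noteq> j \<longrightarrow> sin (snd (\<omega> i) - snd (\<omega> j)) \<noteq> 0"
  proof (cases "i < m \<and> j < m \<and> i \<noteq> j")
    case True
    then have [measurable]: "i < m" "j < m" and "i \<noteq> j" by auto
    have "AE \<omega> in buffon_space m. sin (snd (\<omega> i) - snd (\<omega> j)) \<noteq> 0"
    proof (rule AE_buffon_space[of i])
      show "AE p in placement_measure. sin (snd ((x(i := p)) i) - snd ((x(i := p)) j)) \<noteq> 0" for x
        using AE_placement_transversal[of "snd (x j)"] \<open>i \<noteq> j\<close> by simp
    qed (use \<open>i < m\<close> in auto)
    then show ?thesis by eventually_elim simp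
  qed auto
qed

text \<open>Only segment \<open>k\<close> is resampled. The crossing point of the axes of
  \<open>i\<close> and \<open>j\<close> is then fixed, and a random line almost surely misses
  it.\<close>

lemma AE_no_three_concurrent:
  "AE \<omega> in buffon_space m. \<forall>i j k. i < m \<longrightarrow> j < m \<longrightarrow> k < m \<longrightarrow> i \<noteq> k \<longrightarrow> j \<noteq> k \<longrightarrow>
     cross (fst (\<omega> k) - axes_intersection (\<omega> i) (\<omega> j)) (direction (\<omega> k)) \<noteq> 0"
  unfolding AE_all_countable
proof (intro allI)
  fix i j k
  show "AE \<omega> in buffon_space m. i < m \<longrightarrow> j < m \<longrightarrow> k < m \<longrightarrow> i \<noteq> k \<longrightarrow> j \<noteq> k \<longrightarrow>
     cross (fst (\<omega> k) - axes_intersection (\<omega> i) (\<omega> j)) (direction (\<omega> k)) \<noteq> 0"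
  proof (cases "i < m \<and> j < m \<and> k < m \<and> i \<noteq> k \<and> j \<noteq> k")
    case True
    then have [measurable]: "i < m" "j < m" "k < m" and "i \<noteq> k" "j \<noteq> k" by auto
    have "AE \<omega> in buffon_space m. cross (fst (\<omega> k) - axes_intersection (\<omega> i) (\<omega> j)) (direction (\<omega> k)) \<noteq> 0"
    proof (rule AE_buffon_space[of k])
      show "AE p in placement_measure. cross (fst ((x(k := p)) k) -
          axes_intersection ((x(k := p)) i) ((x(k := p)) j)) (direction ((x(k := p)) k)) \<noteq> 0" for x
        using AE_placement_misses[of "axes_intersection (x i) (x j)"] \<open>i \<noteq> k\<close> \<open>j \<noteq> k\<close> by simp
    qed (use \<open>k < m\<close> in \<open>auto intro: measurable\<close>)
    then show ?thesis by eventually_elim simp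
  qed auto
qed

section \<open>Pair probabilities of order \<open>r\<^sup>2\<close>\<close>

lemma prob_near_le:
  assumes i: "i < m" and j: "j < m" and "i \<noteq> j" "r \<ge> 0"
  shows "(\<integral>\<^sup>+ \<omega>. indicator {\<omega>. near r (\<omega> i) (\<omega> j)} \<omega> \<partial>buffon_space m) \<le> ennreal (4 * r\<^sup>2)"
proof -
  note [measurable] = i j
  have "(\<integral>\<^sup>+ \<omega>. indicator {\<omega>. near r (\<omega> i) (\<omega> j)} \<omega> \<partial>buffon_space m)
    = (\<integral>\<^sup>+ x. (\<integral>\<^sup>+ p. indicator {\<omega>. near r (\<omega> i) (\<omega> j)} (x(j := p)) \<partial>placement_measure)
        \<partial>Pi\<^sub>M ({..<m} - {j}) (\<lambda>_. placement_measure))"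
    by (rule nn_integral_buffon_space[OF j]) measurable
  also have "\<dots> = (\<integral>\<^sup>+ x. emeasure placement_measure {p. near r (x i) p} \<partial>Pi\<^sub>M ({..<m} - {j}) (\<lambda>_. placement_measure))"
  proof (rule nn_integral_cong)
    fix x :: "nat \<Rightarrow> point \<times> real"
    have [measurable]: "(\<lambda>p::point \<times> real. x i) \<in> borel \<Otimes>\<^sub>M borel \<rightarrow>\<^sub>M borel \<Otimes>\<^sub>M borel"
      by (simp add: space_pair_measure)
    have "{p \<in> space (borel \<Otimes>\<^sub>M borel). near r (x i) p} \<in> sets (borel \<Otimes>\<^sub>M borel)" by measurable
    then have *: "{p. near r (x i) p} \<in> sets placement_measure"
        by (simp add: sets_placement space_pair_measure)
    have "(\<integral>\<^sup>+ p. indicator {\<omega>. near r (\<omega> i) (\<omega> j)} (x(j := p)) \<partial>placement_measure)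
        = (\<integral>\<^sup>+ p. indicator {p. near r (x i) p} p \<partial>placement_measure)"
      using \<open>i \<noteq> j\<close> by (intro nn_integral_cong) (auto simp: indicator_def)
    then show "(\<integral>\<^sup>+ p. indicator {\<omega>. near r (\<omega> i) (\<omega> j)} (x(j := p)) \<partial>placement_measure)
        = emeasure placement_measure {p. near r (x i) p}" using * by simp
  qed
  also have "\<dots> \<le> (\<integral>\<^sup>+ x. ennreal (4 * r\<^sup>2) \<partial>Pi\<^sub>M ({..<m} - {j}) (\<lambda>_. placement_measure))"
    unfolding near_def using emeasure_placement_near_le[OF \<open>r \<ge> 0\<close>] by (intro nn_integral_mono) blast
  also have "\<dots> = ennreal (4 * r\<^sup>2)"
    by (simp add: prob_space.emeasure_space_1[OF prob_space_PiM[OF prob_space_placement]])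
  finally show ?thesis .
qed

lemma prob_well_crossing_ge:
  assumes i: "i < m" and j: "j < m" and "i \<noteq> j" "0 < r" "r \<le> 1/2"
  shows "ennreal (r\<^sup>2 / 6) \<le> (\<integral>\<^sup>+ \<omega>. indicator {\<omega>. well_crossing r (\<omega> i) (\<omega> j)} \<omega> \<partial>buffon_space m)"
proof -
  note [measurable] = i j
  let ?N = "Pi\<^sub>M ({..<m} - {j}) (\<lambda>_. placement_measure)"
  have "ennreal (r\<^sup>2 / 6) = (\<integral>\<^sup>+ x. ennreal (r\<^sup>2 / 6) \<partial>?N)"
    by (simp add: prob_space.emeasure_space_1[OF prob_space_PiM[OF prob_space_placement]])
  also have "\<dots> \<le> (\<integral>\<^sup>+ x. (\<integral>\<^sup>+ p. indicator {\<omega>. well_crossing r (\<omega> i) (\<omega> j)} (x(j := p)) \<partial>placement_measure) \<partial>?N)"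
  proof (rule nn_integral_mono_AE)
    \<comment> \<open>The estimate for a single placement needs the fixed center in the unit square
      and the fixed angle in \<open>{0..<pi}\<close>, which holds only almost surely.\<close>
    have "AE x in ?N. fst (x i) \<in> unit_square \<and> snd (x i) \<in> {0..<pi}"
      by (rule AE_PiM_component[OF prob_space_placement _ AE_placement_range]) (use assms in auto)
    then show "AE x in ?N. ennreal (r\<^sup>2 / 6)
      \<le> (\<integral>\<^sup>+ p. indicator {\<omega>. well_crossing r (\<omega> i) (\<omega> j)} (x(j := p)) \<partial>placement_measure)"
    proof eventually_elim
      case (elim x)
      have [measurable]: "(\<lambda>p::point \<times> real. x i) \<in> borel \<Otimes>\<^sub>M borel \<rightarrow>\<^sub>M borel \<Otimes>\<^sub>M borel"
        by (simp add: space_pair_measure)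
      have "{p \<in> space (borel \<Otimes>\<^sub>M borel). well_crossing r (x i) p} \<in> sets (borel \<Otimes>\<^sub>M borel)" by measurable
      then have *: "{p. well_crossing r (x i) p} \<in> sets placement_measure"
        by (simp add: sets_placement space_pair_measure)
      have "ennreal (r\<^sup>2 / 6) \<le> emeasure placement_measure {p. well_crossing r (x i) p}"
        unfolding well_crossing_def near_def conj_assoc
        using elim assms by (intro emeasure_placement_crossing_ge) auto
      also have "\<dots> = (\<integral>\<^sup>+ p. indicator {p. well_crossing r (x i) p} p \<partial>placement_measure)"
        using * by simp
      also have "\<dots> = (\<integral>\<^sup>+ p. indicator {\<omega>. well_crossing r (\<omega> i) (\<omega> j)} (x(j := p)) \<partial>placement_measure)"
        using \<open>i \<noteq> j\<close> by (intro nn_integral_cong) (auto simp: indicator_def)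
      finally show ?case .
    qed
  qed
  also have "\<dots> = (\<integral>\<^sup>+ \<omega>. indicator {\<omega>. well_crossing r (\<omega> i) (\<omega> j)} \<omega> \<partial>buffon_space m)"
    by (rule nn_integral_buffon_space[OF j, symmetric]) measurable
  finally show ?thesis .
qed

section \<open>Expected complexity\<close>

text \<open>The complexity is enclosed between sums of measurable indicators, so its integral can be
  estimated by monotonicity alone. The upper sum runs over ordered pairs, the lower one over pairs
  with \<open>i < j\<close>.\<close>

lemma complexity_buffon_set_bounds:
  assumes l: "l > 0" and r: "r \<le> l/8"
  shows "AE \<omega> in buffon_space m.
      of_nat (complexity (buffon_set m l \<omega>))
        \<le> 4 * (\<Sum>i<m. 2 + (\<Sum>j\<in>{..<m} - {i}. indicator {\<omega>. near l (\<omega> i) (\<omega> j)} \<omega> :: ennreal)) \<and>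
      ennreal (1/3) * ((\<Sum>i<m. \<Sum>j\<in>{i<..<m}. indicator {\<omega>. well_crossing r (\<omega> i) (\<omega> j)} \<omega>) + of_nat m)
        \<le> of_nat (complexity (buffon_set m l \<omega>))"
  using AE_transversal AE_no_three_concurrent
proof eventually_elim
  case (elim \<omega>)
  interpret segment_arrangement m l \<omega>
    using l elim(1) by unfold_locales auto
  have simple: "x \<notin> seg k" if ijk: "i < m" "j < m" "k < m" "i \<noteq> j" "i \<noteq> k" "j \<noteq> k"
    and x: "x \<in> seg i" "x \<in> seg j" for i j k x
  proof
    assume "x \<in> seg k"
    then obtain s t u where stu: "x = axis_point (\<omega> i) s" "x = axis_point (\<omega> j) t" "x = axis_point (\<omega> k) u"
      using x unfolding seg_image by blast
    then have "x = axes_intersection (\<omega> i) (\<omega> j)"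
      using axes_intersection_unique[OF transversal[OF ijk(1,2,4)], of s t] by simp
    then have "cross (fst (\<omega> k) - x) (direction (\<omega> k)) \<noteq> 0" using elim(2) ijk by simp
    then show False using cross_axis_point[of "\<omega> k" u] stu by simp
  qed
  have sum_ind: "(\<Sum>j\<in>A. indicator {\<omega>. P (\<omega> i) (\<omega> j)} \<omega> :: ennreal) = of_nat (card {j\<in>A. P (\<omega> i) (\<omega> j)})"
    if "finite A" for A P i
    using that by (simp add: indicator_def sum.If_cases Int_def)
  have "complexity M \<le> 4 * (\<Sum>i<m. 2 + card {j \<in> {..<m} - {i}. near l (\<omega> i) (\<omega> j)})"
  proof (rule order_trans[OF complexity_le], intro mult_left_mono sum_mono add_left_mono card_mono)
    fix i assume "i \<in> {..<m}"
    show "neighbours i \<subseteq> {j \<in> {..<m} - {i}. near l (\<omega> i) (\<omega> j)}"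
      using near_of_placed_segments_meet[OF l] unfolding neighbours_def by blast
  qed auto
  then have "(of_nat (complexity M) :: ennreal) \<le> of_nat (4 * (\<Sum>i<m. 2 + card {j \<in> {..<m} - {i}. near l (\<omega> i) (\<omega> j)}))"
    by (rule of_nat_mono)
  also have "\<dots> = 4 * (\<Sum>i<m. 2 + (\<Sum>j\<in>{..<m} - {i}. indicator {\<omega>. near l (\<omega> i) (\<omega> j)} \<omega>))"
    by (simp add: sum_ind del: add_2_eq_Suc add_2_eq_Suc')
  finally have upper: "of_nat (complexity M) \<le> 4 * (\<Sum>i<m. 2 + (\<Sum>j\<in>{..<m} - {i}. indicator {\<omega>. near l (\<omega> i) (\<omega> j)} \<omega> :: ennreal))" .
  define c where "c = (\<Sum>i<m. card {j \<in> {i<..<m}. well_crossing r (\<omega> i) (\<omega> j)})"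
  have "c \<le> (\<Sum>i<m. card {j \<in> neighbours i. i < j})"
    unfolding c_def
  proof (intro sum_mono card_mono)
    fix i assume "i \<in> {..<m}"
    have "seg i \<inter> seg j \<noteq> {}" if "well_crossing r (\<omega> i) (\<omega> j)" for j
      using that r by (intro placed_segments_meet_of_well_crossing[OF l]) (auto simp: well_crossing_def near_def)
    then show "{j \<in> {i<..<m}. well_crossing r (\<omega> i) (\<omega> j)} \<subseteq> {j \<in> neighbours i. i < j}"
      by (auto simp: neighbours_def)
  qed (auto simp: neighbours_def)
  moreover have "(\<Sum>i<m. card {j \<in> neighbours i. i < j}) + m \<le> 3 * complexity M"
    by (rule complexity_lower) (fact simple)
  ultimately have "c + m \<le> 3 * complexity M"
    by (meson add_right_mono order_trans)
  then have "real (c + m) \<le> real (3 * complexity M)" by (simp only: of_nat_le_iff)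
  then have "1/3 * real (c + m) \<le> real (complexity M)" by simp
  then have "ennreal (1/3 * real (c + m)) \<le> ennreal (real (complexity M))" by (rule ennreal_leI)
  then have "ennreal (1/3) * of_nat (c + m) \<le> of_nat (complexity M)"
    unfolding ennreal_of_nat_eq_real_of_nat by (subst ennreal_mult[symmetric]) auto
  moreover have "(\<Sum>i<m. \<Sum>j\<in>{i<..<m}. indicator {\<omega>. well_crossing r (\<omega> i) (\<omega> j)} \<omega> :: ennreal) = of_nat c"
    unfolding c_def by (subst sum_ind) (auto simp: of_nat_sum)
  ultimately show ?case using upper by simp
qed

lemma prob_space_buffon_space: "prob_space (buffon_space m)"
  unfolding buffon_space_def by (rule prob_space_PiM[OF prob_space_placement])

text \<open>By linearity the expectation is at most 4 times a sum of \<open>m\<close> terms, each at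
  most \<open>2 + m * 4 * l\<^sup>2\<close>.\<close>

lemma nn_integral_complexity_le:
  assumes l: "l > 0"
  shows "(\<integral>\<^sup>+ \<omega>. of_nat (complexity (buffon_set m l \<omega>)) \<partial>buffon_space m)
    \<le> ennreal (16 * ((real m)\<^sup>2 * l\<^sup>2 + real m))"
proof -
  interpret prob_space "buffon_space m" by (rule prob_space_buffon_space)
  let ?I = "\<lambda>i j. indicator {\<omega>. near l (\<omega> i) (\<omega> j)} :: (nat \<Rightarrow> point \<times> real) \<Rightarrow> ennreal"
  have meas [measurable]: "?I i j \<in> borel_measurable (buffon_space m)" if [measurable]: "i < m" "j < m" for i j
    by measurable
  have "(\<integral>\<^sup>+ \<omega>. of_nat (complexity (buffon_set m l \<omega>)) \<partial>buffon_space m)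
      \<le> (\<integral>\<^sup>+ \<omega>. 4 * (\<Sum>i<m. 2 + (\<Sum>j\<in>{..<m} - {i}. ?I i j \<omega>)) \<partial>buffon_space m)"
    by (rule nn_integral_mono_AE, rule AE_mp[OF complexity_buffon_set_bounds[OF l order_refl]]) (intro AE_I2 impI, blast)
  also have "\<dots> = 4 * (\<Sum>i<m. 2 + (\<Sum>j\<in>{..<m} - {i}. \<integral>\<^sup>+ \<omega>. ?I i j \<omega> \<partial>buffon_space m))"
  proof (subst nn_integral_cmult)
    have "(\<integral>\<^sup>+ \<omega>. (\<Sum>j\<in>{..<m} - {i}. ?I i j \<omega>) \<partial>buffon_space m)
        = (\<Sum>j\<in>{..<m} - {i}. \<integral>\<^sup>+ \<omega>. ?I i j \<omega> \<partial>buffon_space m)" if "i < m" for i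
      using that by (intro nn_integral_sum meas) auto
    then have "(\<integral>\<^sup>+ \<omega>. 2 + (\<Sum>j\<in>{..<m} - {i}. ?I i j \<omega>) \<partial>buffon_space m)
        = 2 + (\<Sum>j\<in>{..<m} - {i}. \<integral>\<^sup>+ \<omega>. ?I i j \<omega> \<partial>buffon_space m)" if "i < m" for i
      using that by (subst nn_integral_add) (auto intro!: borel_measurable_sum meas simp: emeasure_space_1)
    moreover have "(\<integral>\<^sup>+ \<omega>. (\<Sum>i<m. 2 + (\<Sum>j\<in>{..<m} - {i}. ?I i j \<omega>)) \<partial>buffon_space m)
        = (\<Sum>i<m. \<integral>\<^sup>+ \<omega>. 2 + (\<Sum>j\<in>{..<m} - {i}. ?I i j \<omega>) \<partial>buffon_space m)"
      by (rule nn_integral_sum) (auto intro!: borel_measurable_add borel_measurable_sum meas)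
    ultimately show "4 * (\<integral>\<^sup>+ \<omega>. (\<Sum>i<m. 2 + (\<Sum>j\<in>{..<m} - {i}. ?I i j \<omega>)) \<partial>buffon_space m)
        = 4 * (\<Sum>i<m. 2 + (\<Sum>j\<in>{..<m} - {i}. \<integral>\<^sup>+ \<omega>. ?I i j \<omega> \<partial>buffon_space m))"
      by (metis (no_types, lifting) lessThan_iff sum.cong)
  qed (auto intro!: borel_measurable_add borel_measurable_sum meas)
  also have "\<dots> \<le> 4 * (\<Sum>i<m. 2 + (\<Sum>j\<in>{..<m} - {i}. ennreal (4 * l\<^sup>2)))"
    using l by (intro mult_left_mono sum_mono add_left_mono prob_near_le) auto
  also have "\<dots> \<le> 4 * (\<Sum>i<m. 2 + (\<Sum>j<m. ennreal (4 * l\<^sup>2)))"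
    by (intro mult_left_mono sum_mono add_left_mono sum_mono2) auto
  also have "\<dots> = ennreal (4 * (real m * (2 + real m * (4 * l\<^sup>2))))"
    by (simp add: ennreal_mult ennreal_plus ennreal_of_nat_eq_real_of_nat)
  also have "\<dots> \<le> ennreal (16 * ((real m)\<^sup>2 * l\<^sup>2 + real m))"
    by (intro ennreal_leI) (simp add: algebra_simps power2_eq_square)
  finally show ?thesis .
qed

text \<open>Linearity again: there are \<open>m * (m - 1) / 2\<close> pairs, each well crossing with
  probability at least \<open>r\<^sup>2 / 6\<close>.\<close>

lemma nn_integral_complexity_ge:
  assumes l: "l > 0" and r: "0 < r" "r \<le> l/8" "r \<le> 1/2"
  shows "ennreal (1/3 * (real m * (real m - 1) / 2 * (r\<^sup>2 / 6) + real m))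
    \<le> (\<integral>\<^sup>+ \<omega>. of_nat (complexity (buffon_set m l \<omega>)) \<partial>buffon_space m)"
proof -
  interpret prob_space "buffon_space m" by (rule prob_space_buffon_space)
  let ?I = "\<lambda>i j. indicator {\<omega>. well_crossing r (\<omega> i) (\<omega> j)} :: (nat \<Rightarrow> point \<times> real) \<Rightarrow> ennreal"
  have meas [measurable]: "?I i j \<in> borel_measurable (buffon_space m)" if [measurable]: "i < m" "j < m" for i j
    by measurable
  have pairs: "(\<Sum>i<m. \<Sum>j\<in>{i<..<m}. x) = real m * (real m - 1) / 2 * x" for x :: real
  proof -
    have "(\<Sum>i<n. real (n - Suc i)) = real n * (real n - 1) / 2" for n
      by (subst sum.nat_diff_reindex) (induction n; simp add: field_simps)
    then show ?thesis by (simp flip: sum_distrib_right)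
  qed
  have "ennreal (1/3 * (real m * (real m - 1) / 2 * (r\<^sup>2 / 6) + real m))
      = ennreal (1/3) * (ennreal (\<Sum>i<m. \<Sum>j\<in>{i<..<m}. r\<^sup>2 / 6) + of_nat m)"
    unfolding pairs[symmetric] ennreal_of_nat_eq_real_of_nat
    by (subst ennreal_mult, simp, (intro add_nonneg_nonneg sum_nonneg; simp), subst ennreal_plus)
       (auto intro!: sum_nonneg)
  also have "\<dots> = ennreal (1/3) * ((\<Sum>i<m. \<Sum>j\<in>{i<..<m}. ennreal (r\<^sup>2 / 6)) + of_nat m)"
    by (simp add: sum_nonneg del: sum_constant flip: sum_ennreal)
  also have "\<dots> \<le> ennreal (1/3) * ((\<Sum>i<m. \<Sum>j\<in>{i<..<m}. \<integral>\<^sup>+ \<omega>. ?I i j \<omega> \<partial>buffon_space m) + of_nat m)"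
    using r by (intro mult_left_mono add_right_mono sum_mono prob_well_crossing_ge) auto
  also have "\<dots> = (\<integral>\<^sup>+ \<omega>. ennreal (1/3) * ((\<Sum>i<m. \<Sum>j\<in>{i<..<m}. ?I i j \<omega>) + of_nat m) \<partial>buffon_space m)"
  proof -
    have "(\<integral>\<^sup>+ \<omega>. (\<Sum>i<m. \<Sum>j\<in>{i<..<m}. ?I i j \<omega>) \<partial>buffon_space m)
        = (\<Sum>i<m. \<integral>\<^sup>+ \<omega>. (\<Sum>j\<in>{i<..<m}. ?I i j \<omega>) \<partial>buffon_space m)"
      by (rule nn_integral_sum) (auto intro!: borel_measurable_sum meas)
    also have "\<dots> = (\<Sum>i<m. \<Sum>j\<in>{i<..<m}. \<integral>\<^sup>+ \<omega>. ?I i j \<omega> \<partial>buffon_space m)"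
      by (intro sum.cong refl nn_integral_sum meas) auto
    finally show ?thesis
      by (subst nn_integral_cmult, (auto intro!: borel_measurable_sum meas)[1], subst nn_integral_add)
         (auto intro!: borel_measurable_sum meas simp: emeasure_space_1)
  qed
  also have "\<dots> \<le> (\<integral>\<^sup>+ \<omega>. of_nat (complexity (buffon_set m l \<omega>)) \<partial>buffon_space m)"
    by (rule nn_integral_mono_AE, rule AE_mp[OF complexity_buffon_set_bounds[OF l r(2)]]) (intro AE_I2 impI, blast)
  finally show ?thesis .
qed

text \<open>The principal filter makes the bounds hold for every \<open>m\<close> and every positive
  length up to \<open>L\<close>, with constants depending on \<open>L\<close>. Lengths have to be
  bounded: the number of crossings is at most quadratic in \<open>m\<close> however long the
  segments are, while \<open>m\<^sup>2 * l\<^sup>2\<close> grows with \<open>l\<close>.\<close>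

theorem theorem6:
  fixes L :: real
  assumes "L > 0"
  shows "(\<lambda>(m, l). expected_complexity m l)
    \<in> \<Theta>[principal (UNIV \<times> {0<..L})](\<lambda>(m, l). (real m)\<^sup>2 * l\<^sup>2 + real m)"
proof -
  have upper: "expected_complexity m l \<le> 16 * ((real m)\<^sup>2 * l\<^sup>2 + real m)" if "l > 0" for m l
    unfolding expected_complexity_def
    by (rule enn2real_leI[OF _ nn_integral_complexity_le[OF that]]) simp
  define K where "K = max 1 L"
  have K: "1 \<le> K" "L \<le> K" by (auto simp: K_def)
  have lower: "(real m)\<^sup>2 * l\<^sup>2 + real m \<le> 2304 * K\<^sup>2 * expected_complexity m l"
    if l: "0 < l" "l \<le> L" for m l
  proof -
    \<comment> \<open>Dividing by \<open>K \<ge> 1\<close> keeps \<open>r \<le> l/8\<close>, and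
      \<open>l \<le> K\<close> gives \<open>r \<le> 1/8\<close>, below the required 1/2.\<close>
    define r where "r = l / (8 * K)"
    have r: "0 < r" "r \<le> l/8" "r \<le> 1/2"
      using l K by (auto simp: r_def field_simps)
    define n where "n = real m * (real m - 1)"
    have n: "0 \<le> n" by (cases m) (auto simp: n_def)
    have "1/3 * (n / 2 * (r\<^sup>2 / 6) + real m) \<le> expected_complexity m l"
    proof -
      have "ennreal (1/3 * (n / 2 * (r\<^sup>2 / 6) + real m)) \<le> (\<integral>\<^sup>+ \<omega>. of_nat (complexity (buffon_set m l \<omega>)) \<partial>buffon_space m)"
        unfolding n_def by (rule nn_integral_complexity_ge[OF l(1) r])
      then have "enn2real (ennreal (1/3 * (n / 2 * (r\<^sup>2 / 6) + real m))) \<le> expected_complexity m l"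
        unfolding expected_complexity_def
        \<comment> \<open>Monotonicity of \<open>enn2real\<close> requires a finite right-hand side;
          the upper bound supplies it.\<close>
        using order_le_less_trans[OF nn_integral_complexity_le[OF l(1), of m]]
        by (intro enn2real_mono) (auto simp: ennreal_less_top)
      then show ?thesis using n by simp
    qed
    \<comment> \<open>Since \<open>2304 = 3 * 2 * 6 * 64\<close>, the factor turns the coefficient
      of \<open>n * l\<^sup>2\<close> into 1. The linear term becomes
      \<open>768 * K\<^sup>2 * m\<close>, which absorbs both \<open>m * l\<^sup>2\<close>, the gap
      between \<open>n * l\<^sup>2\<close> and \<open>m\<^sup>2 * l\<^sup>2\<close>, and the summand
      \<open>m\<close>.\<close>
    then have "2304 * K\<^sup>2 * (1/3 * (n / 2 * (r\<^sup>2 / 6) + real m)) \<le> 2304 * K\<^sup>2 * expected_complexity m l"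
      by (intro mult_left_mono) auto
    moreover have "2304 * K\<^sup>2 * (1/3 * (n / 2 * (r\<^sup>2 / 6) + real m)) = n * l\<^sup>2 + 768 * K\<^sup>2 * real m"
      using K by (simp add: r_def power_divide power_mult_distrib field_simps)
    moreover have "(real m)\<^sup>2 * l\<^sup>2 = n * l\<^sup>2 + real m * l\<^sup>2"
      by (simp add: n_def power2_eq_square algebra_simps)
    moreover have "real m * l\<^sup>2 \<le> real m * K\<^sup>2"
      using l K by (intro mult_left_mono power_mono) auto
    moreover have "real m * 1 \<le> real m * K\<^sup>2"
      using K by (intro mult_left_mono) auto
    ultimately show ?thesis by (simp add: mult.commute)
  qed
  have nonneg: "0 \<le> expected_complexity m l" for m l by (simp add: expected_complexity_def)
  show ?thesis
  proof (rule bigthetaI)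
    show "(\<lambda>(m, l). expected_complexity m l) \<in> O[principal (UNIV \<times> {0<..L})](\<lambda>(m, l). (real m)\<^sup>2 * l\<^sup>2 + real m)"
      by (rule bigoI[of _ 16]) (use upper in \<open>auto simp: eventually_principal nonneg simp del: distrib_left_numeral\<close>)
    have "(\<lambda>(m, l). (real m)\<^sup>2 * l\<^sup>2 + real m) \<in> O[principal (UNIV \<times> {0<..L})](\<lambda>(m, l). expected_complexity m l)"
      by (rule bigoI[of _ "2304 * K\<^sup>2"]) (auto simp: eventually_principal nonneg lower)
    then show "(\<lambda>(m, l). expected_complexity m l) \<in> \<Omega>[principal (UNIV \<times> {0<..L})](\<lambda>(m, l). (real m)\<^sup>2 * l\<^sup>2 + real m)"
      by (simp add: bigomega_iff_bigo)
  qed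
qed

end
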